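(* Let $j\ge4$ and let $A=R/I$ be a graded Artinian Gorenstein algebra of socle degree $j$ with Hilbert function $H=(1,4,7,\dots)$ and $I_2=\langle wx,wy,wz\rangle$. Let $F\in\mathcal D_j$ be a dual generator, $I=\mathrm{Ann}(F)$, and $R'=K[x,y,z]$. Then: (i) the degree-$j$ component of the inverse system of the ideal $(wx,wy,wz)$ is $\langle K_{DP}[X,Y,Z]_j,\,W^{[j]}\rangle$; (ii) $F=G+\alpha W^{[j]}$ with $G\in K_{DP}[X,Y,Z]_j$, $G\ne0$, and $\alpha\in K$, $\alpha\ne0$. The ideal $J_I=I\cap R'$ is the height three Gorenstein ideal $\mathrm{Ann}_{R'}(G)$, and there is $g\in R'_j$, $g\ne0$ (with $g\notin J_I$), such that $I=(J_I,wx,wy,wz,w^j-g)$, these being minimal generators. Moreover $H(R/I)_i=H(R'/J_I)_i+1$ for $1\le i\le j-1$, i.e. $H(R/I)=H(R'/J_I)+(0,1,1,\dots,1,0)$; the inverse system satisfies $I^\perp_j=\langle F\rangle$, $I^\perp_i=0$ for $i>j$, and $I^\perp_i=(R\circ F)_i=\langle (R'\circ G)_i,W^{[i]}\rangle$ for $1\le i\le j-1$. (iii) For a Gorenstein sequence $H=(1,4,7,\dots)$ of socle degree $j\ge 4$, the family $\mathfrak C(H)$ is nonempty if and only if $H'=H-(0,1,1,\dots,1,0)$ is a Gorenstein sequence of height three.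
   Context: $K$ is an algebraically closed field, $R=K[w,x,y,z]$ standard graded. $\mathcal D=K_{DP}[W,X,Y,Z]$ is the divided power algebra, with basis $W^{[a]}X^{[b]}Y^{[c]}Z^{[d]}$, on which $R$ acts by contraction: $x^i\circ X^{[k]}=X^{[k-i]}$ if $k\ge i$ and $0$ otherwise, extended variable by variable and linearly. For a graded Artinian Gorenstein algebra $A=R/I$ of socle degree $j$ there is $F\in\mathcal D_j$, unique up to nonzero scalar (the dual generator), with $I=\mathrm{Ann}(F)=\{h\in R: h\circ F=0\}$; the inverse system $I^\perp=\{G\in\mathcal D: h\circ G=0\ \forall h\in I\}$ equals $R\circ F$. Similarly for $R'=K[x,y,z]$ acting on $K_{DP}[X,Y,Z]$. A Gorenstein sequence of height three is the Hilbert function of a graded Artinian Gorenstein quotient of $R'$ with $h_1=3$. $\mathbb{P}\mathrm{Gor}(H)$ is the scheme parametrizing graded Artinian Gorenstein quotients $R/I$ with Hilbert function $H$, and $\mathfrak C(H)\subset\mathbb{P}\mathrm{Gor}(H)$ is the subfamily of those $R/I$ for which $I_2$ is carried to $\langle wx,wy,wz\rangle$ by a linear change of coordinates. *)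

theory Defs
  imports "HOL-Library.Poly_Mapping" "HOL-Computational_Algebra.Polynomial"
begin

datatype var = vW | vX | vY | vZ

text \<open>Both R = K[w,x,y,z] and the divided power algebra D = K_DP[W,X,Y,Z] are
  represented by finitely supported coefficient functions on monomials
  (exponent vectors var =>0 nat). For R the ring structure is the usual one
  (poly_mapping convolution); for D only the K-vector space structure and the
  contraction action are used, the monomial with exponent vector a standing for
  the divided power monomial W^[a_w] X^[a_x] Y^[a_y] Z^[a_z].\<close>
type_synonym 'k mpoly = "(var \<Rightarrow>\<^sub>0 nat) \<Rightarrow>\<^sub>0 'k"

definition mdeg :: "(var \<Rightarrow>\<^sub>0 nat) \<Rightarrow> nat" where
  "mdeg m = (\<Sum>v\<in>Poly_Mapping.keys m. Poly_Mapping.lookup m v)"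

definition Var :: "var \<Rightarrow> 'k::comm_ring_1 mpoly" where
  "Var v = Poly_Mapping.single (Poly_Mapping.single v 1) 1"

text \<open>Divided power monomial V^[n] (for D); as a polynomial it is v^n.\<close>
definition DPow :: "var \<Rightarrow> nat \<Rightarrow> 'k::comm_ring_1 mpoly" where
  "DPow v n = Poly_Mapping.single (Poly_Mapping.single v n) 1"

definition smult :: "'k::comm_ring_1 \<Rightarrow> 'k mpoly \<Rightarrow> 'k mpoly" where
  "smult c p = Poly_Mapping.map (\<lambda>a. c * a) p"

abbreviation kspan :: "'k::field mpoly set \<Rightarrow> 'k mpoly set" where
  "kspan S \<equiv> module.span smult S"

abbreviation kdim :: "'k::field mpoly set \<Rightarrow> nat" where
  "kdim S \<equiv> vector_space.dim smult S"

definition polyring :: "var set \<Rightarrow> 'k::zero mpoly set" where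
  "polyring V = {p. \<forall>m\<in>Poly_Mapping.keys p. Poly_Mapping.keys m \<subseteq> V}"

definition R'vars :: "var set" where
  "R'vars = {vX, vY, vZ}"

definition forms :: "var set \<Rightarrow> nat \<Rightarrow> 'k::zero mpoly set" where
  "forms V i = {p \<in> polyring V. \<forall>m\<in>Poly_Mapping.keys p. mdeg m = i}"

definition hcomp :: "nat \<Rightarrow> 'k::zero mpoly \<Rightarrow> 'k mpoly" where
  "hcomp i p = Abs_poly_mapping (\<lambda>m. if mdeg m = i then Poly_Mapping.lookup p m else 0)"

definition is_ideal :: "var set \<Rightarrow> 'k::comm_ring_1 mpoly set \<Rightarrow> bool" where
  "is_ideal V I \<longleftrightarrow> I \<subseteq> polyring V \<and> 0 \<in> I \<and> (\<forall>p\<in>I. \<forall>q\<in>I. p + q \<in> I)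
     \<and> (\<forall>p\<in>I. \<forall>r\<in>polyring V. r * p \<in> I)"

definition graded_ideal :: "var set \<Rightarrow> 'k::comm_ring_1 mpoly set \<Rightarrow> bool" where
  "graded_ideal V I \<longleftrightarrow> is_ideal V I \<and> (\<forall>p\<in>I. \<forall>i. hcomp i p \<in> I)"

definition ideal_gen :: "var set \<Rightarrow> 'k::comm_ring_1 mpoly set \<Rightarrow> 'k mpoly set" where
  "ideal_gen V B = \<Inter>{I. is_ideal V I \<and> B \<subseteq> I}"

definition minimal_gens :: "var set \<Rightarrow> 'k::comm_ring_1 mpoly set \<Rightarrow> 'k mpoly set \<Rightarrow> bool" where
  "minimal_gens V I B \<longleftrightarrow> (\<forall>b\<in>B. \<exists>i. b \<in> forms V i) \<and> ideal_gen V B = I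
     \<and> (\<forall>b\<in>B. b \<notin> ideal_gen V (B - {b}))"

definition artinian :: "var set \<Rightarrow> 'k::comm_ring_1 mpoly set \<Rightarrow> bool" where
  "artinian V I \<longleftrightarrow> (\<exists>N. \<forall>i\<ge>N. forms V i \<subseteq> I)"

text \<open>Preimage in K[V] of the socle (0 : m) of K[V]/I.\<close>
definition socle :: "var set \<Rightarrow> 'k::comm_ring_1 mpoly set \<Rightarrow> 'k mpoly set" where
  "socle V I = {p \<in> polyring V. \<forall>v\<in>V. Var v * p \<in> I}"

definition gorenstein :: "var set \<Rightarrow> 'k::comm_ring_1 mpoly set \<Rightarrow> bool" where
  "gorenstein V I \<longleftrightarrow> (\<exists>s\<in>socle V I. s \<notin> I \<and> (\<forall>p\<in>socle V I. \<exists>c. p - smult c s \<in> I))"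

definition socle_degree :: "var set \<Rightarrow> 'k::comm_ring_1 mpoly set \<Rightarrow> nat \<Rightarrow> bool" where
  "socle_degree V I j \<longleftrightarrow> \<not> forms V j \<subseteq> I \<and> (\<forall>i>j. forms V i \<subseteq> I)"

definition graded_AG :: "var set \<Rightarrow> 'k::comm_ring_1 mpoly set \<Rightarrow> nat \<Rightarrow> bool" where
  "graded_AG V I j \<longleftrightarrow> graded_ideal V I \<and> artinian V I \<and> gorenstein V I \<and> socle_degree V I j"

definition hilb :: "var set \<Rightarrow> 'k::field mpoly set \<Rightarrow> nat \<Rightarrow> nat" where
  "hilb V I i = kdim (forms V i :: 'k mpoly set) - kdim (I \<inter> forms V i)"

text \<open>h o F: the coefficient of the divided power monomial of exponent k is
  sum over m of h_m * F_(m+k), i.e. x^m o X^[n] = X^[n-m] if m <= n, else 0.\<close>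
definition contract :: "'k::comm_ring_1 mpoly \<Rightarrow> 'k mpoly \<Rightarrow> 'k mpoly" where
  "contract h F = Abs_poly_mapping (\<lambda>k. \<Sum>m\<in>Poly_Mapping.keys h. Poly_Mapping.lookup h m * Poly_Mapping.lookup F (m + k))"

definition Ann :: "var set \<Rightarrow> 'k::comm_ring_1 mpoly \<Rightarrow> 'k mpoly set" where
  "Ann V F = {h \<in> polyring V. contract h F = 0}"

definition perp :: "var set \<Rightarrow> 'k::comm_ring_1 mpoly set \<Rightarrow> 'k mpoly set" where
  "perp V I = {G \<in> polyring V. \<forall>h\<in>I. contract h G = 0}"

definition act_orbit :: "var set \<Rightarrow> 'k::comm_ring_1 mpoly \<Rightarrow> 'k mpoly set" where
  "act_orbit V F = {contract h F | h. h \<in> polyring V}"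

definition gor_seq :: "'k::field itself \<Rightarrow> var set \<Rightarrow> (nat \<Rightarrow> nat) \<Rightarrow> bool" where
  "gor_seq _ V H \<longleftrightarrow> (\<exists>(I::'k mpoly set) j. graded_AG V I j \<and> (\<forall>i. hilb V I i = H i))"

definition subst :: "(var \<Rightarrow> 'k::comm_ring_1 mpoly) \<Rightarrow> 'k mpoly \<Rightarrow> 'k mpoly" where
  "subst \<sigma> p = (\<Sum>m\<in>Poly_Mapping.keys p. smult (Poly_Mapping.lookup p m) (\<Prod>v\<in>Poly_Mapping.keys m. \<sigma> v ^ Poly_Mapping.lookup m v))"

definition linear_change :: "(var \<Rightarrow> 'k::comm_ring_1 mpoly) \<Rightarrow> bool" where
  "linear_change \<sigma> \<longleftrightarrow> (\<forall>v. \<sigma> v \<in> forms UNIV 1) \<and>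
     (\<exists>\<tau>. (\<forall>v. \<tau> v \<in> forms UNIV 1) \<and> (\<forall>v. subst \<sigma> (\<tau> v) = Var v) \<and> (\<forall>v. subst \<tau> (\<sigma> v) = Var v))"

definition C_nonempty :: "(nat \<Rightarrow> nat) \<Rightarrow> 'k::field itself \<Rightarrow> bool" where
  "C_nonempty H _ \<longleftrightarrow> (\<exists>(I::'k mpoly set) j. graded_AG UNIV I j \<and> (\<forall>i. hilb UNIV I i = H i) \<and>
     (\<exists>\<sigma>. linear_change \<sigma> \<and> subst \<sigma> ` (I \<inter> forms UNIV 2)
         = kspan {Var vW * Var vX, Var vW * Var vY, Var vW * Var vZ}))"

definition alg_closed :: "'k::field itself \<Rightarrow> bool" where
  "alg_closed _ \<longleftrightarrow> (\<forall>p::'k poly. Polynomial.degree p > 0 \<longrightarrow> (\<exists>x. poly p x = 0))"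

end

theory Submission
  imports Defs
begin

text \<open>
  Macaulay duality turns a graded Artinian Gorenstein ideal of socle degree \<open>j\<close> into the annihilator of
  a form of degree \<open>j\<close>. A form killed by \<open>wx, wy, wz\<close> has no mixed monomials, so \<open>F = G + \<alpha> W\<^sup>[\<^sup>j\<^sup>]\<close>, and
  \<open>I\<^sub>1 = 0\<close> forces \<open>G\<close> and \<open>\<alpha>\<close> to be nonzero. For \<open>h\<close> of degree \<open>i\<close> strictly between \<open>0\<close> and \<open>j\<close> the two summands of
  \<open>h \<circ> F\<close> lie in independent spaces: \<open>h\<close> annihilates \<open>F\<close> iff \<open>h(0,x,y,z)\<close> annihilates \<open>G\<close> and the
  coefficient of \<open>w\<^sup>i\<close> in \<open>h\<close> vanishes. Hence \<open>w\<^sup>i\<close> contributes one extra dimension in each such degree,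
  while \<open>w\<^sup>j\<close> is identified with some \<open>g\<close> having \<open>g \<circ> G = \<alpha>\<close>. Conversely, a dual generator \<open>G\<close> of a
  height three Gorenstein ideal yields \<open>G + W\<^sup>[\<^sup>s\<^sup>]\<close>.
\<close>

text \<open>The delicate point is minimality of the generators, claimed for every minimal generating
  set \<open>B\<close> of J. Setting w = 0 kills wx, wy, wz but turns w^j - g into -g, so a member
  of \<open>B\<close> might become redundant modulo g. Below degree j a multiple of g cannot
  intervene, and in degree j it would force g into J. Above degree j this argument breaks down;
  instead J turns out to have no minimal generators there, because J contains no linear form and so
  the contractions of G by two distinct variables are independent. The other new generators are
  tested by contraction: wx, wy, wz against themselves, and w^j - g against W^[j]. Vanishing of J in
  degrees 1 and 2 comes from H(1) = 4 and the shape of I_2. The converse in (iii) uses the numerical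
  counterpart: H'(2) = 6 is the number of quadratic monomials in x, y, z, so J_2 = 0 and I_2
  consists of mixed quadrics only. Hilbert functions are compared through bases of complements
  instead of quotient spaces.\<close>

abbreviation lookup where "lookup \<equiv> Poly_Mapping.lookup"
abbreviation keys where "keys \<equiv> Poly_Mapping.keys"
abbreviation single where "single \<equiv> Poly_Mapping.single"

section \<open>Monomials, coefficients and homogeneous components\<close>

lemma UNIV_var: "UNIV = {vW, vX, vY, vZ}"
  by (auto intro: var.exhaust)

instance var :: finite
  by standard (simp add: UNIV_var)

lemma mdeg_eq: "mdeg m = lookup m vW + lookup m vX + lookup m vY + lookup m vZ"
proof -
  have "mdeg m = (\<Sum>v\<in>UNIV. lookup m v)"
    unfolding mdeg_def by (rule sum.mono_neutral_left) (auto simp: in_keys_iff)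
  then show ?thesis by (simp add: UNIV_var)
qed

lemma mdeg_add [simp]: "mdeg (m + n) = mdeg m + mdeg n"
  by (simp add: mdeg_eq lookup_add)

lemma mdeg_zero [simp]: "mdeg 0 = 0"
  by (simp add: mdeg_eq)

lemma mdeg_eq_0_iff: "mdeg m = 0 \<longleftrightarrow> m = 0"
proof
  assume "mdeg m = 0"
  then have "lookup m v = 0" for v by (cases v) (auto simp: mdeg_eq)
  then show "m = 0" by (intro poly_mapping_eqI) simp
qed simp

lemma mdeg_single [simp]: "mdeg (single v n) = n"
  by (cases v) (auto simp: mdeg_eq lookup_single)

lemma keys_add_nat: "keys (m + n :: var \<Rightarrow>\<^sub>0 nat) = keys m \<union> keys n"
  by (auto simp: in_keys_iff lookup_add)

lemma lookup_smult [simp]: "lookup (smult c p) m = c * lookup p m"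
  by (simp add: smult_def Poly_Mapping.map.rep_eq when_def)

interpretation mp: vector_space "smult :: 'k::field \<Rightarrow> 'k mpoly \<Rightarrow> 'k mpoly"
  by unfold_locales (auto intro!: poly_mapping_eqI simp: lookup_add algebra_simps)

text \<open>Scalars act as constant polynomials, so facts about \<open>smult\<close> reduce to ring
  arithmetic and to closure of ideals under products.\<close>

lemma smult_conv_mult: "smult c p = single 0 c * p"
  by (simp add: smult_def mult_map_scale_conv_mult)

lemma smult_single: "smult c (single m a) = single m (c * a)"
  by (intro poly_mapping_eqI) (simp add: lookup_single when_def)

lemma mult_smult_right: "p * smult c q = smult c (p * q)"
  by (simp add: smult_conv_mult algebra_simps)

lemma mpoly_sum_single: "(p :: 'a \<Rightarrow>\<^sub>0 'b::comm_monoid_add) = (\<Sum>m\<in>keys p. single m (lookup p m))"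
  by (intro poly_mapping_eqI) (simp add: lookup_sum lookup_single when_def in_keys_iff)

text \<open>The monomial case keeps \<open>m \<in> keys p\<close>, so whatever is known about the
  degree or the variables of the fixed \<open>p\<close> stays available there, although the
  coefficient and the summands are arbitrary.\<close>

lemma mpoly_induct [case_names zero single add]:
  fixes p :: "'a \<Rightarrow>\<^sub>0 'b::comm_monoid_add"
  assumes "P 0" "\<And>m c. m \<in> keys p \<Longrightarrow> P (single m c)" "\<And>p q. P p \<Longrightarrow> P q \<Longrightarrow> P (p + q)"
  shows "P p"
proof -
  have "finite S \<Longrightarrow> S \<subseteq> keys p \<Longrightarrow> P (\<Sum>m\<in>S. single m (lookup p m))" for S
    by (induct S rule: finite_induct) (auto intro: assms)
  from this[of "keys p"] show ?thesis by (subst mpoly_sum_single) simp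
qed

lemma lookup_hcomp [simp]: "lookup (hcomp i p) m = (if mdeg m = i then lookup p m else 0)"
proof -
  have "finite {m. (if mdeg m = i then lookup p m else 0) \<noteq> 0}"
    by (rule finite_subset[of _ "keys p"]) (auto simp: in_keys_iff)
  then show ?thesis by (simp add: hcomp_def)
qed

lemma lookup_single_mult:
  "lookup (single m c * p) (m + k) = c * lookup (p :: 'k::comm_ring_1 mpoly) k"
proof (induct p rule: mpoly_induct)
  case (single n a)
  then show ?case by (simp add: mult_single lookup_single when_def)
qed (auto simp: algebra_simps lookup_add)

lemma lookup_single_mult_eq_0:
  assumes "\<And>k. n \<noteq> m + k"
  shows "lookup (single m c * p) n = (0::'k::comm_ring_1)"
proof (induct p rule: mpoly_induct)
  case (single l a)
  have "m + l \<noteq> n" using assms[of l] by auto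
  then show ?case by (simp add: mult_single lookup_single when_def)
qed (auto simp: algebra_simps lookup_add)

lemma hcomp_add: "hcomp i (p + q) = hcomp i p + hcomp i q"
  by (intro poly_mapping_eqI) (simp add: lookup_add)

lemma hcomp_diff: "hcomp i (p - q) = hcomp i p - hcomp i (q :: 'k::comm_ring_1 mpoly)"
  by (intro poly_mapping_eqI) (simp add: lookup_minus)

lemma hcomp_zero [simp]: "hcomp i 0 = 0"
  by (intro poly_mapping_eqI) simp

lemma hcomp_smult: "hcomp i (smult c p) = smult c (hcomp i p)"
  by (intro poly_mapping_eqI) simp

lemma hcomp_single_mult:
  "hcomp i (single m c * p) =
    (if mdeg m \<le> i then single m c * hcomp (i - mdeg m) p else (0 :: 'k::comm_ring_1 mpoly))"
proof (rule poly_mapping_eqI)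
  fix n
  show "lookup (hcomp i (single m c * p)) n =
    lookup (if mdeg m \<le> i then single m c * hcomp (i - mdeg m) p else 0) n"
  proof (cases "\<exists>k. n = m + k")
    case True
    then obtain k where "n = m + k" by blast
    then show ?thesis by (auto simp: lookup_single_mult)
  next
    case False
    then show ?thesis by (simp add: lookup_single_mult_eq_0)
  qed
qed

section \<open>The contraction action\<close>

lemma lookup_contract:
  "lookup (contract h F) k = (\<Sum>m\<in>keys h. lookup h m * lookup F (m + k))"
proof -
  \<comment> \<open>\<open>contract\<close> is built with \<open>Abs_poly_mapping\<close>, so its
    support must be finite: a nonzero value at \<open>k\<close> puts \<open>m + k\<close> into
    \<open>keys F\<close> for some \<open>m\<close> in \<open>keys h\<close>, and adding
    \<open>m\<close> is injective.\<close>
  have "finite {k. (\<Sum>m\<in>keys h. lookup h m * lookup F (m + k)) \<noteq> 0}"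
  proof (rule finite_subset)
    show "{k. (\<Sum>m\<in>keys h. lookup h m * lookup F (m + k)) \<noteq> 0}
      \<subseteq> (\<Union>m\<in>keys h. (\<lambda>k. m + k) -` keys F)"
    proof
      fix k assume "k \<in> {k. (\<Sum>m\<in>keys h. lookup h m * lookup F (m + k)) \<noteq> 0}"
      then obtain m where "m \<in> keys h" "lookup h m * lookup F (m + k) \<noteq> 0"
        by (auto dest: sum.not_neutral_contains_not_neutral)
      then show "k \<in> (\<Union>m\<in>keys h. (\<lambda>k. m + k) -` keys F)"
        by (intro UN_I[of m]) (auto simp: in_keys_iff)
    qed
    show "finite (\<Union>m\<in>keys h. (\<lambda>k. m + k) -` keys F)"
      by (auto intro!: finite_vimageI injI)
  qed
  then show ?thesis by (simp add: contract_def)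
qed

lemma lookup_contract_superset:
  assumes "finite A" "keys h \<subseteq> A"
  shows "lookup (contract h F) k = (\<Sum>m\<in>A. lookup h m * lookup F (m + k))"
  unfolding lookup_contract using assms by (intro sum.mono_neutral_left) (auto simp: in_keys_iff)

lemma lookup_contract_single [simp]:
  "lookup (contract (single m a) F) k = a * lookup F (m + k)"
  by (subst lookup_contract_superset[of "{m}"]) auto

lemma contract_zero_left [simp]: "contract 0 F = 0"
  by (intro poly_mapping_eqI) (simp add: lookup_contract)

lemma contract_zero_right [simp]: "contract h 0 = 0"
  by (intro poly_mapping_eqI) (simp add: lookup_contract)

lemma contract_add_left: "contract (p + q) F = contract p F + contract q F"
proof (rule poly_mapping_eqI)
  fix k
  have "finite (keys p \<union> keys q)" "keys (p + q) \<subseteq> keys p \<union> keys q"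
    by (auto simp: Poly_Mapping.keys_add)
  then show "lookup (contract (p + q) F) k = lookup (contract p F + contract q F) k"
    by (simp add: lookup_add lookup_contract_superset[of "keys p \<union> keys q"] algebra_simps sum.distrib)
qed

lemma contract_add_right: "contract h (F + G) = contract h F + contract h G"
  by (intro poly_mapping_eqI) (simp add: lookup_contract lookup_add algebra_simps sum.distrib)

lemma contract_smult_left: "contract (smult c h) F = smult c (contract h F)"
proof (induct h rule: mpoly_induct)
  case zero
  then show ?case by (auto intro!: poly_mapping_eqI simp: smult_conv_mult)
next
  case (single m a)
  then show ?case by (auto intro!: poly_mapping_eqI simp: smult_single algebra_simps)
next
  case (add p q)
  then show ?case
    by (simp add: contract_add_left smult_conv_mult algebra_simps)
qed

lemma contract_smult_right: "contract h (smult c F) = smult c (contract h F)"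
  by (intro poly_mapping_eqI) (simp add: lookup_contract sum_distrib_left algebra_simps)

lemma contract_uminus_left: "contract (- p) F = - contract p F"
  using contract_add_left[of p "- p" F] by (simp add: eq_neg_iff_add_eq_0 add.commute)

lemma contract_diff_left: "contract (p - q) F = contract p F - contract q F"
  using contract_add_left[of p "- q" F] by (simp add: contract_uminus_left)

lemma contract_constant_term: "contract (single 0 c) H = smult c H"
  by (intro poly_mapping_eqI) simp

text \<open>Both sides are bilinear in \<open>p\<close> and \<open>q\<close>, and on monomials
  exponents add. This is the module law; with commutativity of R it lets two contractions be
  exchanged.\<close>

lemma contract_mult: "contract (p * q) F = contract p (contract q F)"
proof (induct p rule: mpoly_induct)
  case (single m a)
  show ?case
  proof (induct q rule: mpoly_induct)
    case (single n b)
    show ?case by (intro poly_mapping_eqI) (simp add: mult_single algebra_simps)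
  qed (auto simp: algebra_simps contract_add_left contract_add_right)
qed (auto simp: algebra_simps contract_add_left contract_add_right)

subsection \<open>Polynomials in a subset of the variables\<close>

lemma polyring_UNIV [simp]: "polyring UNIV = UNIV"
  by (simp add: polyring_def)

lemma polyring_lookup: "p \<in> polyring V \<Longrightarrow> \<not> keys m \<subseteq> V \<Longrightarrow> lookup p m = 0"
  by (auto simp: polyring_def in_keys_iff)

lemma polyringI: "(\<And>m. \<not> keys m \<subseteq> V \<Longrightarrow> lookup p m = 0) \<Longrightarrow> p \<in> polyring V"
  by (auto simp: polyring_def in_keys_iff)

lemma polyring_zero [simp]: "0 \<in> polyring V"
  by (simp add: polyring_def)

lemma polyring_single: "keys m \<subseteq> V \<Longrightarrow> single m c \<in> polyring V"
  by (simp add: polyring_def)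

lemma polyring_add: "p \<in> polyring V \<Longrightarrow> q \<in> polyring V \<Longrightarrow> p + q \<in> polyring V"
  by (intro polyringI) (simp add: lookup_add polyring_lookup)

lemma polyring_diff:
  "p \<in> polyring V \<Longrightarrow> q \<in> polyring V \<Longrightarrow> p - q \<in> (polyring V :: 'k::comm_ring_1 mpoly set)"
  by (intro polyringI) (simp add: lookup_minus polyring_lookup)

lemma polyring_smult: "p \<in> polyring V \<Longrightarrow> smult c p \<in> polyring V"
  by (intro polyringI) (simp add: polyring_lookup)

lemma polyring_hcomp: "p \<in> polyring V \<Longrightarrow> hcomp i p \<in> polyring V"
  by (intro polyringI) (simp add: polyring_lookup)

lemma polyring_mult:
  fixes p :: "'k::comm_ring_1 mpoly"
  assumes "p \<in> polyring V" "q \<in> polyring V"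
  shows "p * q \<in> polyring V"
  unfolding polyring_def
proof (intro CollectI ballI)
  fix m assume "m \<in> keys (p * q)"
  then obtain a b where "m = a + b" "a \<in> keys p" "b \<in> keys q"
    using Poly_Mapping.keys_mult[of p q] by auto
  then show "keys m \<subseteq> V"
    using assms by (auto simp: polyring_def keys_add_nat)
qed

text \<open>The coefficient at \<open>k\<close> reads \<open>G\<close> at exponents
  \<open>m + k\<close>, whose variables include those of \<open>k\<close>; so \<open>h\<close> may
  involve variables outside \<open>V\<close>.\<close>

lemma polyring_contract: "G \<in> polyring V \<Longrightarrow> contract h G \<in> polyring V"
  by (intro polyringI) (simp add: lookup_contract keys_add_nat polyring_lookup)

subsection \<open>Forms and homogeneous components\<close>

lemma forms_iff: "p \<in> forms V i \<longleftrightarrow> p \<in> polyring V \<and> (\<forall>m. mdeg m \<noteq> i \<longrightarrow> lookup p m = 0)"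
  by (auto simp: forms_def in_keys_iff)

lemma formsI: "p \<in> polyring V \<Longrightarrow> (\<And>m. mdeg m \<noteq> i \<Longrightarrow> lookup p m = 0) \<Longrightarrow> p \<in> forms V i"
  by (simp add: forms_iff)

lemma forms_lookup: "p \<in> forms V i \<Longrightarrow> mdeg m \<noteq> i \<Longrightarrow> lookup p m = 0"
  by (simp add: forms_iff)

lemma forms_polyring: "p \<in> forms V i \<Longrightarrow> p \<in> polyring V"
  by (simp add: forms_iff)

lemma forms_zero [simp]: "0 \<in> forms V i"
  by (simp add: forms_iff)

lemma forms_add: "p \<in> forms V i \<Longrightarrow> q \<in> forms V i \<Longrightarrow> p + q \<in> forms V i"
  by (simp add: forms_iff polyring_add lookup_add)

lemma forms_diff:
  "p \<in> forms V i \<Longrightarrow> q \<in> forms V i \<Longrightarrow> p - q \<in> (forms V i :: 'k::comm_ring_1 mpoly set)"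
  by (simp add: forms_iff polyring_diff lookup_minus)

lemma forms_smult: "p \<in> forms V i \<Longrightarrow> smult c p \<in> forms V i"
  by (simp add: forms_iff polyring_smult)

lemma forms_single: "keys m \<subseteq> V \<Longrightarrow> mdeg m = i \<Longrightarrow> single m c \<in> forms V i"
  by (auto simp: forms_iff polyring_single lookup_single when_def)

lemma forms_mono: "V \<subseteq> V' \<Longrightarrow> p \<in> forms V i \<Longrightarrow> p \<in> forms V' i"
  by (auto simp: forms_def polyring_def)

lemma forms_mult:
  fixes p :: "'k::comm_ring_1 mpoly"
  assumes "p \<in> forms V a" "q \<in> forms V b"
  shows "p * q \<in> forms V (a + b)"
  unfolding forms_def
proof (intro CollectI conjI ballI)
  show "p * q \<in> polyring V"
    using assms by (auto simp: forms_def polyring_mult)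
  fix m assume "m \<in> keys (p * q)"
  then obtain k l where "m = k + l" "k \<in> keys p" "l \<in> keys q"
    using Poly_Mapping.keys_mult[of p q] by auto
  then show "mdeg m = a + b"
    using assms by (auto simp: forms_def)
qed

lemma forms_hcomp: "p \<in> polyring V \<Longrightarrow> hcomp i p \<in> forms V i"
  by (simp add: forms_iff polyring_hcomp)

lemma hcomp_form: "p \<in> forms V i \<Longrightarrow> hcomp k p = (if k = i then p else 0)"
  by (intro poly_mapping_eqI) (auto simp: forms_lookup)

lemma mpoly_sum_hcomp: "p = (\<Sum>i\<in>mdeg ` keys p. hcomp i p)"
proof (rule poly_mapping_eqI)
  fix m
  have "(\<Sum>i\<in>mdeg ` keys p. if mdeg m = i then lookup p m else 0) = lookup p m"
    by (auto simp: in_keys_iff)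
  then show "lookup p m = lookup (\<Sum>i\<in>mdeg ` keys p. hcomp i p) m"
    by (simp add: lookup_sum)
qed

lemma subspace_forms: "mp.subspace (forms V i)"
  by (simp add: mp.subspace_def forms_add forms_smult)

text \<open>A monomial of degree d lowers degrees by d, so degree \<open>k\<close> of the result
  comes from the part of \<open>h\<close> of degree \<open>j - k\<close>. For \<open>k > j\<close>
  the truncated difference would pick out the constant term of \<open>h\<close>, hence the separate
  case.\<close>

lemma hcomp_contract:
  assumes "F \<in> forms V j"
  shows "hcomp k (contract h F) = (if k \<le> j then contract (hcomp (j - k) h) F else 0)"
proof (rule poly_mapping_eqI)
  fix n
  have fin: "finite (keys h)" "keys (hcomp (j - k) h) \<subseteq> keys h"
    by (auto simp: in_keys_iff split: if_splits)
  have 1: "lookup (hcomp (j - k) h) m * lookup F (m + n) = (if mdeg n = k then lookup h m * lookup F (m + n) else 0)"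
    if "k \<le> j" for m
    using that forms_lookup[OF assms, of "m + n"] by auto
  have 2: "lookup F (m + n) = 0" if "mdeg n = k" "\<not> k \<le> j" for m
    using that by (intro forms_lookup[OF assms]) auto
  show "lookup (hcomp k (contract h F)) n
      = lookup (if k \<le> j then contract (hcomp (j - k) h) F else 0) n"
  proof (cases "k \<le> j")
    case True
    have "lookup (contract (hcomp (j - k) h) F) n
        = (\<Sum>m\<in>keys h. lookup (hcomp (j - k) h) m * lookup F (m + n))"
      by (rule lookup_contract_superset[OF fin])
    also have "\<dots> = (if mdeg n = k then lookup (contract h F) n else 0)"
      by (simp only: 1[OF True] lookup_contract) simp
    finally show ?thesis using True by simp
  next
    case False
    then show ?thesis using 2 by (simp add: lookup_contract)
  qed
qed

lemma contract_forms:
  assumes "F \<in> forms V j" "h \<in> forms U i" "i \<le> j"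
  shows "contract h F \<in> forms V (j - i)"
proof -
  have "contract h F = contract (hcomp i h) F"
    using hcomp_form[OF assms(2), of i] by simp
  also have "\<dots> = hcomp (j - i) (contract h F)"
    using assms(3) by (simp add: hcomp_contract[OF assms(1)])
  finally show ?thesis
    using forms_hcomp[OF polyring_contract[OF forms_polyring[OF assms(1)], of h], of "j - i"] by simp
qed

lemma contract_high_degree:
  assumes "F \<in> forms V j" "h \<in> forms U i" "i > j"
  shows "contract h F = 0"
proof (rule poly_mapping_eqI)
  fix k
  have "lookup h m * lookup F (m + k) = 0" for m
    using forms_lookup[OF assms(1), of "m + k"] forms_lookup[OF assms(2), of m] assms(3)
    by (cases "mdeg m = i") auto
  then show "lookup (contract h F) k = lookup 0 k"
    by (simp add: lookup_contract)
qed

lemma forms_0: "p \<in> forms V 0 \<Longrightarrow> p = single 0 (lookup p 0)"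
  by (intro poly_mapping_eqI) (auto simp: lookup_single when_def forms_iff mdeg_eq_0_iff)

text \<open>The constant term of a contraction is the sum of products of matching coefficients. This
  symmetric form is the pairing between R and the divided powers for which monomials are dual
  bases.\<close>

lemma lookup_contract_commute: "lookup (contract p F) 0 = lookup (contract F p) 0"
proof -
  have "finite (keys p \<union> keys F)" by simp
  then show ?thesis
    by (simp add: lookup_contract_superset[of "keys p \<union> keys F"] mult.commute)
qed

text \<open>Contracting by the monomial \<open>k\<close> moves the coefficient at \<open>k\<close>
  to the constant term, which expresses every coefficient of a contraction through the symmetric
  pairing.\<close>

lemma lookup_contract_conv: "lookup (contract h F) k = lookup (contract h (contract (single k 1) F)) 0"
proof -
  have "contract h (contract (single k 1) F) = contract (single k 1) (contract h F)"
    by (metis contract_mult mult.commute)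
  then show ?thesis by simp
qed

lemma contract_constant:
  assumes "F \<in> forms V j" "h \<in> forms U j"
  shows "contract h F = single 0 (lookup (contract h F) 0)"
proof (rule forms_0)
  show "contract h F \<in> forms V 0" using contract_forms[OF assms] by simp
qed

subsection \<open>Ideals\<close>

lemma is_idealD:
  assumes "is_ideal V I"
  shows "I \<subseteq> polyring V" "0 \<in> I" "p \<in> I \<Longrightarrow> q \<in> I \<Longrightarrow> p + q \<in> I"
    "p \<in> I \<Longrightarrow> r \<in> polyring V \<Longrightarrow> r * p \<in> I"
  using assms by (auto simp: is_ideal_def)

lemma is_ideal_smult: "is_ideal V I \<Longrightarrow> p \<in> I \<Longrightarrow> smult c p \<in> I"
  by (simp add: smult_conv_mult is_idealD(4) polyring_single)

lemma is_ideal_diff: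
  assumes "is_ideal V I" "p \<in> I" "q \<in> I"
  shows "p - q \<in> I"
proof -
  have "p - q = p + smult (-1) q" by (intro poly_mapping_eqI) (simp add: lookup_minus lookup_add)
  also have "\<dots> \<in> I" by (intro is_idealD(3)[OF assms(1)] is_ideal_smult[OF assms(1)] assms)
  finally show ?thesis .
qed

lemma is_ideal_sum: "is_ideal V I \<Longrightarrow> (\<And>a. a \<in> A \<Longrightarrow> f a \<in> I) \<Longrightarrow> (\<Sum>a\<in>A. f a) \<in> I"
  by (induct A rule: infinite_finite_induct) (auto simp: is_idealD)

lemma subspace_ideal: "is_ideal V I \<Longrightarrow> mp.subspace I"
  by (simp add: mp.subspace_def is_idealD is_ideal_smult)

lemma is_idealI:
  assumes "I \<subseteq> polyring V" "0 \<in> I" "\<And>p q. p \<in> I \<Longrightarrow> q \<in> I \<Longrightarrow> p + q \<in> I"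
    "\<And>m c p. keys m \<subseteq> V \<Longrightarrow> p \<in> I \<Longrightarrow> single m c * p \<in> I"
  shows "is_ideal V I"
proof -
  have "r * p \<in> I" if "p \<in> I" "r \<in> polyring V" for r p
  proof (induct r rule: mpoly_induct)
    case zero
    show ?case using assms(2) by simp
  next
    case (single m c)
    then have "keys m \<subseteq> V" using that(2) by (auto simp: polyring_def)
    then show ?case using that(1) by (rule assms(4))
  next
    case (add q q')
    then show ?case using assms(3) by (simp add: distrib_right)
  qed
  then show ?thesis using assms(1-3) by (auto simp: is_ideal_def)
qed

lemma is_ideal_ideal_gen:
  assumes "B \<subseteq> polyring V"
  shows "is_ideal V (ideal_gen V B)"
proof -
  have "is_ideal V (polyring V)"
    by (simp add: is_ideal_def polyring_add polyring_mult)
  with assms have "ideal_gen V B \<subseteq> polyring V"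
    unfolding ideal_gen_def by blast
  then show ?thesis
    unfolding is_ideal_def by (auto simp: ideal_gen_def is_idealD)
qed

lemma ideal_gen_superset: "B \<subseteq> ideal_gen V B"
  by (auto simp: ideal_gen_def)

lemma ideal_gen_least: "is_ideal V I \<Longrightarrow> B \<subseteq> I \<Longrightarrow> ideal_gen V B \<subseteq> I"
  by (auto simp: ideal_gen_def)

lemma graded_ideal_subset:
  assumes "graded_ideal V I" "is_ideal V I'" "\<And>i p. p \<in> I \<Longrightarrow> p \<in> forms V i \<Longrightarrow> p \<in> I'"
  shows "I \<subseteq> I'"
proof
  fix p assume p: "p \<in> I"
  then have "hcomp i p \<in> I'" for i
    using assms by (intro assms(3)[of _ i] forms_hcomp) (auto simp: graded_ideal_def is_ideal_def)
  then show "p \<in> I'"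
    by (subst mpoly_sum_hcomp) (rule is_ideal_sum[OF assms(2)])
qed

text \<open>The polynomials whose components all lie in the generated ideal themselves form an
  ideal, and it contains the homogeneous generators.\<close>

lemma graded_ideal_gen:
  fixes B :: "'k::comm_ring_1 mpoly set"
  assumes "\<And>b. b \<in> B \<Longrightarrow> \<exists>i. b \<in> forms V i"
  shows "graded_ideal V (ideal_gen V B)"
proof -
  let ?S = "{p \<in> polyring V. \<forall>i. hcomp i p \<in> ideal_gen V B}"
  have B: "B \<subseteq> polyring V" using assms by (auto simp: forms_def)
  note id = is_ideal_ideal_gen[OF B]
  have "is_ideal V ?S"
    by (rule is_idealI)
      (auto simp: polyring_add hcomp_add hcomp_single_mult is_idealD[OF id]
        polyring_single polyring_mult)
  moreover have "B \<subseteq> ?S"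
  proof
    fix b assume "b \<in> B"
    with assms obtain i where "b \<in> forms V i" by blast
    with \<open>b \<in> B\<close> ideal_gen_superset[of B V] show "b \<in> ?S"
      by (auto simp: hcomp_form forms_polyring is_idealD[OF id])
  qed
  ultimately show ?thesis
    using id ideal_gen_least[of V ?S B] by (auto simp: graded_ideal_def)
qed

lemma is_ideal_Ann: "is_ideal V (Ann V F)"
  by (auto simp: is_ideal_def Ann_def contract_add_left contract_mult polyring_add polyring_mult)

lemma ideal_gen_subset_Ann:
  "B \<subseteq> polyring V \<Longrightarrow> (\<And>b. b \<in> B \<Longrightarrow> contract b F = 0) \<Longrightarrow> ideal_gen V B \<subseteq> Ann V F"
  by (intro ideal_gen_least is_ideal_Ann) (auto simp: Ann_def)

lemma graded_ideal_Ann: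
  assumes "F \<in> forms U j"
  shows "graded_ideal V (Ann V F)"
proof -
  have "hcomp i h \<in> Ann V F" if "h \<in> Ann V F" for i h
  proof (cases "i \<le> j")
    case True
    then have "contract (hcomp i h) F = hcomp (j - i) (contract h F)"
      by (simp add: hcomp_contract[OF assms])
    with that show ?thesis by (simp add: Ann_def polyring_hcomp)
  next
    case False
    with that show ?thesis
      by (auto simp: Ann_def polyring_hcomp contract_high_degree[OF assms forms_hcomp])
  qed
  then show ?thesis by (simp add: graded_ideal_def is_ideal_Ann)
qed

subsection \<open>Macaulay duality\<close>

lemma finite_mdeg: "finite {m. mdeg m = i}"
proof -
  have "{m. mdeg m = i} \<subseteq> (\<lambda>(a, b, c, d). single vW a + single vX b + single vY c + single vZ d) `
      ({..i} \<times> {..i} \<times> {..i} \<times> {..i})"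
  proof
    fix m assume "m \<in> {m. mdeg m = i}"
    then have "m = single vW (lookup m vW) + single vX (lookup m vX) + single vY (lookup m vY)
        + single vZ (lookup m vZ) \<and> (\<forall>v. lookup m v \<le> i)"
    proof (intro conjI allI poly_mapping_eqI)
      fix v show "lookup m v \<le> i" using \<open>m \<in> _\<close> by (cases v) (auto simp: mdeg_eq)
      show "lookup m v = lookup (single vW (lookup m vW) + single vX (lookup m vX)
          + single vY (lookup m vY) + single vZ (lookup m vZ)) v"
        by (cases v) (auto simp: lookup_add lookup_single)
    qed
    then show "m \<in> (\<lambda>(a, b, c, d). single vW a + single vX b + single vY c + single vZ d) `
      ({..i} \<times> {..i} \<times> {..i} \<times> {..i})"
      by (auto intro!: image_eqI[of _ _ "(lookup m vW, lookup m vX, lookup m vY, lookup m vZ)"])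
  qed
  then show ?thesis by (rule finite_subset) simp
qed

text \<open>One half of Macaulay duality. The socle of the quotient is a line because a socle
  element contracts \<open>F\<close> to something killed by every variable, that is to a constant,
  while \<open>s\<close> contracts \<open>F\<close> to 1.\<close>

lemma graded_AG_Ann:
  fixes F :: "'k::field mpoly"
  assumes F: "F \<in> forms V j" "F \<noteq> 0"
  shows "graded_AG V (Ann V F) j"
proof -
  from F(2) obtain m where m: "lookup F m \<noteq> 0"
    by (metis lookup_zero poly_mapping_eqI)
  have mV: "keys m \<subseteq> V" "mdeg m = j"
    using m polyring_lookup[OF forms_polyring[OF F(1)], of m] forms_lookup[OF F(1), of m] by auto
  \<comment> \<open>A monomial of \<open>F\<close> divided by its coefficient; in degree
    \<open>j\<close> a contraction is a constant, and this choice makes it 1.\<close>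
  define s where "s = single m (inverse (lookup F m))"
  have sj: "s \<in> forms V j" unfolding s_def using mV by (rule forms_single)
  have s0: "lookup (contract s F) 0 = 1"
    using m by (simp add: s_def)
  have s1: "contract s F = 1"
    using contract_constant[OF F(1) sj] s0 by simp
  have high: "forms V i \<subseteq> Ann V F" if "i > j" for i
    using that contract_high_degree[OF F(1)] by (auto simp: Ann_def forms_polyring)
  have "s \<in> socle V (Ann V F)"
  proof -
    have "Var v * s \<in> Ann V F" if "v \<in> V" for v
    proof -
      have "Var v \<in> forms V 1"
        unfolding Var_def using that by (intro forms_single) auto
      from forms_mult[OF this sj] high[of "1 + j"] show ?thesis by auto
    qed
    then show ?thesis using sj by (simp add: socle_def forms_polyring)
  qed
  moreover have "s \<notin> Ann V F"
    by (simp add: Ann_def s1)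
  moreover have "\<exists>c. p - smult c s \<in> Ann V F" if p: "p \<in> socle V (Ann V F)" for p
  proof -
    have 1: "contract (Var v) (contract p F) = 0" if "v \<in> V" for v
      using p that by (auto simp: socle_def Ann_def contract_mult)
    have "contract p F = single 0 (lookup (contract p F) 0)"
    proof (rule poly_mapping_eqI)
      fix k
      \<comment> \<open>A nonzero \<open>k\<close> over \<open>V\<close> contains some variable
        \<open>v\<close>, and the coefficient at \<open>k\<close> is a coefficient of the further
        contraction by \<open>Var v\<close>, which is zero for a socle element.\<close>
      have "lookup (contract p F) k = 0" if "k \<noteq> 0"
      proof (cases "keys k \<subseteq> V")
        case True
        from that obtain v where v: "lookup k v \<noteq> 0"
          by (metis lookup_zero poly_mapping_eqI)
        then have "v \<in> V" using True by (auto simp: in_keys_iff)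
        define k' where "k' = k - single v 1"
        have "k = single v 1 + k'"
          unfolding k'_def using v
          by (intro poly_mapping_eqI) (auto simp: lookup_add lookup_minus lookup_single when_def)
        then have "lookup (contract p F) k = lookup (contract (Var v) (contract p F)) k'"
          by (simp add: Var_def)
        then show ?thesis using 1[OF \<open>v \<in> V\<close>] by simp
      next
        case False
        then show ?thesis
          using polyring_lookup[OF polyring_contract[OF forms_polyring[OF F(1)]]] by blast
      qed
      then show "lookup (contract p F) k = lookup (single 0 (lookup (contract p F) 0)) k"
        by (auto simp: lookup_single when_def)
    qed
    then have "contract (p - smult (lookup (contract p F) 0) s) F = 0"
      by (simp add: contract_diff_left contract_smult_left s1 smult_single flip: single_one)
    moreover have "p - smult (lookup (contract p F) 0) s \<in> polyring V"
      using p sj by (simp add: socle_def polyring_diff polyring_smult forms_polyring)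
    ultimately show ?thesis by (auto simp: Ann_def)
  qed
  ultimately have "gorenstein V (Ann V F)"
    unfolding gorenstein_def by blast
  moreover have "artinian V (Ann V F)"
    unfolding artinian_def using high by (intro exI[of _ "Suc j"]) auto
  moreover have "socle_degree V (Ann V F) j"
    unfolding socle_degree_def using high sj \<open>s \<notin> Ann V F\<close> by blast
  ultimately show ?thesis
    by (simp add: graded_AG_def graded_ideal_Ann[OF F(1)])
qed

text \<open>Adding \<open>x\<close> to a basis of \<open>U\<close> keeps it independent, so values 1
  at \<open>x\<close> and 0 on the basis extend to a linear functional.\<close>

lemma exists_functional:
  fixes U :: "'k::field mpoly set"
  assumes "mp.subspace U" "x \<notin> U"
  obtains f :: "'k mpoly \<Rightarrow> 'k" where
    "\<And>p q. f (p + q) = f p + f q" "\<And>c p. f (smult c p) = c * f p"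
    "\<And>u. u \<in> U \<Longrightarrow> f u = 0" "f x = 1"
proof -
  interpret fl: vector_space "(*) :: 'k \<Rightarrow> 'k \<Rightarrow> 'k"
    by unfold_locales (auto simp: algebra_simps)
  interpret pr: vector_space_pair "smult :: 'k \<Rightarrow> 'k mpoly \<Rightarrow> 'k mpoly" "(*) :: 'k \<Rightarrow> 'k \<Rightarrow> 'k" ..
  obtain B where B: "B \<subseteq> U" "mp.independent B" "U \<subseteq> mp.span B"
    using mp.maximal_independent_subset by blast
  have "mp.span B \<subseteq> U" using B(1) assms(1) by (rule mp.span_minimal)
  then have "x \<notin> mp.span B" using assms(2) by blast
  then have ind: "mp.independent (insert x B)" using B(2) by (rule mp.independent_insertI)
  obtain f where f: "\<forall>y\<in>insert x B. f y = (if y = x then 1 else 0)"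
      "Vector_Spaces.linear smult (*) f"
    using pr.linear_independent_extend[OF ind, of "\<lambda>y. if y = x then 1 else 0"] by blast
  interpret f: Vector_Spaces.linear smult "(*)" f by (fact f(2))
  show ?thesis
  proof
    show "f (p + q) = f p + f q" for p q by (rule f.add)
    show "f (smult c p) = c * f p" for c p by (rule f.scale)
    show "f x = 1" using f(1) by simp
    fix u assume "u \<in> U"
    then have "u \<in> mp.span B" using B(3) by blast
    moreover have "f b = 0" if "b \<in> B" for b using f(1) that assms(2) B(1) by auto
    ultimately show "f u = 0"
      using f.eq_0_on_span by blast
  qed
qed

text \<open>Monomials are dual bases for the pairing, so the form whose coefficients are the values
  of \<open>f\<close> at the monomials of degree \<open>i\<close> represents \<open>f\<close> on
  forms of that degree.\<close>

lemma functional_form: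
  fixes f :: "'k::field mpoly \<Rightarrow> 'k"
  assumes add: "\<And>p q. f (p + q) = f p + f q" and sm: "\<And>c p. f (smult c p) = c * f p"
  obtains F where "F \<in> forms V i" "\<And>p. p \<in> forms V i \<Longrightarrow> lookup (contract p F) 0 = f p"
proof -
  define S where "S = {m. mdeg m = i \<and> keys m \<subseteq> V}"
  have fin: "finite S" unfolding S_def by (rule finite_subset[OF _ finite_mdeg[of i]]) auto
  define F where "F = (\<Sum>m\<in>S. single m (f (single m 1)))"
  have lF: "lookup F m = (if m \<in> S then f (single m 1) else 0)" for m
    using fin by (auto simp: F_def lookup_sum lookup_single when_def)
  have f0: "f 0 = 0" using sm[of 0 0] by simp
  have fs: "f (\<Sum>a\<in>A. g a) = (\<Sum>a\<in>A. f (g a))" for A :: "(var \<Rightarrow>\<^sub>0 nat) set" and g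
    by (induct A rule: infinite_finite_induct) (auto simp: f0 add)
  show ?thesis
  proof
    show "F \<in> forms V i"
      by (intro formsI polyringI) (auto simp: lF S_def)
    fix p :: "'k mpoly" assume p: "p \<in> forms V i"
    then have keys: "keys p \<subseteq> S" by (auto simp: S_def forms_def polyring_def)
    have "f p = f (\<Sum>m\<in>keys p. single m (lookup p m))"
      by (subst mpoly_sum_single) simp
    also have "\<dots> = (\<Sum>m\<in>keys p. f (smult (lookup p m) (single m 1)))"
      by (simp add: fs smult_single)
    also have "\<dots> = lookup (contract p F) 0"
      unfolding lookup_contract using keys by (intro sum.cong) (auto simp: sm lF)
    finally show "lookup (contract p F) 0 = f p" ..
  qed
qed

text \<open>If \<open>H\<close> were outside the space of contractions of \<open>F\<close> by forms
  of degree \<open>j - i\<close>, a functional would vanish on that space and be 1 at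
  \<open>H\<close>. Represented by a form \<open>h\<close> of degree \<open>i\<close>, it
  annihilates \<open>F\<close>, since each coefficient of the contraction is a value of the
  functional on that space. Then \<open>h\<close> must annihilate \<open>H\<close>, contradicting
  the value 1.\<close>

lemma double_annihilator:
  fixes F :: "'k::field mpoly"
  assumes F: "F \<in> forms V j" and H: "H \<in> forms V i" and "i \<le> j"
    and ann: "\<And>h. h \<in> Ann V F \<Longrightarrow> h \<in> forms V i \<Longrightarrow> contract h H = 0"
  shows "\<exists>r \<in> forms V (j - i). H = contract r F"
proof (rule ccontr)
  define U where "U = (\<lambda>r. contract r F) ` forms V (j - i)"
  assume "\<not> ?thesis"
  then have "H \<notin> U" by (auto simp: U_def)
  moreover have "mp.subspace U"
    unfolding mp.subspace_def U_def
  proof (intro conjI allI ballI)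
    show "0 \<in> (\<lambda>r. contract r F) ` forms V (j - i)"
      by (rule image_eqI[of _ _ 0]) auto
  qed (auto simp: forms_add forms_smult simp flip: contract_add_left contract_smult_left)
  ultimately obtain f :: "'k mpoly \<Rightarrow> 'k" where f: "\<And>p q. f (p + q) = f p + f q"
    "\<And>c p. f (smult c p) = c * f p" "\<And>u. u \<in> U \<Longrightarrow> f u = 0" "f H = 1"
    using exists_functional[of U H] by blast
  obtain h where h: "h \<in> forms V i" "\<And>p. p \<in> forms V i \<Longrightarrow> lookup (contract p h) 0 = f p"
    using functional_form[of f V i, OF f(1,2)] by blast
  have "contract h F = 0"
  proof (rule poly_mapping_eqI)
    fix k
    have hF: "contract h F \<in> forms V (j - i)" using contract_forms[OF F h(1) \<open>i \<le> j\<close>] .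
    show "lookup (contract h F) k = lookup 0 k"
    proof (cases "keys k \<subseteq> V \<and> mdeg k = j - i")
      case True
      have k: "single k 1 \<in> forms V (j - i)" using True by (intro forms_single) auto
      have "contract (single k 1) F \<in> forms V i"
        using contract_forms[OF F k] \<open>i \<le> j\<close> by simp
      moreover have "contract (single k 1) F \<in> U" using k by (auto simp: U_def)
      ultimately show ?thesis
        using h(2) f(3) by (subst lookup_contract_conv, subst lookup_contract_commute) auto
    next
      case False
      then show ?thesis
        using polyring_lookup[OF forms_polyring[OF hF]] forms_lookup[OF hF] by auto
    qed
  qed
  then have "contract h H = 0" using ann[of h] h(1) by (simp add: Ann_def forms_polyring)
  then show False using h(2)[OF H] f(4) by (simp add: lookup_contract_commute[of H])
qed

text \<open>The other half of Macaulay duality. \<open>F\<close> represents a functional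
  \<open>f\<close> that vanishes on \<open>I\<close> but not on all forms of degree
  \<open>j\<close>. Coefficients of the contraction of \<open>F\<close> by a form of
  \<open>I\<close> are values of \<open>f\<close> on multiples of that form, hence zero. Conversely,
  a homogeneous annihilator outside \<open>I\<close> of largest degree would be a socle element of
  degree \<open>j\<close> on which \<open>f\<close> vanishes, and that forces it into
  \<open>I\<close>.\<close>

lemma graded_AG_obtain_dual_generator:
  fixes I :: "'k::field mpoly set"
  assumes "graded_AG V I j"
  obtains F where "F \<in> forms V j" "F \<noteq> 0" "I = Ann V F"
proof -
  have gr: "graded_ideal V I" and ar: "artinian V I" and go: "gorenstein V I" and sd: "socle_degree V I j"
    using assms by (auto simp: graded_AG_def)
  have id: "is_ideal V I" using gr by (simp add: graded_ideal_def)
  obtain p0 where p0: "p0 \<in> forms V j" "p0 \<notin> I" using sd by (auto simp: socle_degree_def)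
  have high: "forms V i \<subseteq> I" if "i > j" for i using sd that by (auto simp: socle_degree_def)
  obtain s where s: "s \<in> socle V I" "s \<notin> I" "\<And>p. p \<in> socle V I \<Longrightarrow> \<exists>c. p - smult c s \<in> I"
    using go by (auto simp: gorenstein_def)
  have Var: "(Var v :: 'k mpoly) \<in> forms V 1" if "v \<in> V" for v
    unfolding Var_def using that by (intro forms_single) auto
  have soc_j: "p \<in> socle V I" if "p \<in> forms V j" for p
    using that high[of "1 + j"] forms_mult[OF Var that] by (auto simp: socle_def forms_polyring)
  \<comment> \<open>The form \<open>p0\<close> also spans the socle: \<open>p\<close> and
    \<open>p0\<close> are both multiples of \<open>s\<close> modulo \<open>I\<close>, and the factor
    \<open>d\<close> of \<open>p0\<close> is nonzero because \<open>p0\<close> is outside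
    \<open>I\<close>.\<close>
  have soc: "\<exists>c. p - smult c p0 \<in> I" if "p \<in> socle V I" for p
  proof -
    obtain c where c: "p - smult c s \<in> I" using s(3) \<open>p \<in> socle V I\<close> by blast
    obtain d where d: "p0 - smult d s \<in> I" using s(3) soc_j[OF p0(1)] by blast
    have "d \<noteq> 0" using d p0(2) by (auto simp: smult_conv_mult)
    then have "(p - smult c s) - smult (c / d) (p0 - smult d s) = p - smult (c / d) p0"
      by (intro poly_mapping_eqI) (simp add: lookup_minus field_simps)
    then have "p - smult (c / d) p0 \<in> I"
      using is_ideal_diff[OF id c is_ideal_smult[OF id d]] by metis
    then show ?thesis ..
  qed
  obtain f :: "'k mpoly \<Rightarrow> 'k" where f: "\<And>p q. f (p + q) = f p + f q"
    "\<And>c p. f (smult c p) = c * f p" "\<And>u. u \<in> I \<Longrightarrow> f u = 0" "f p0 = 1"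
    using exists_functional[OF subspace_ideal[OF id] p0(2)] by blast
  obtain F where F: "F \<in> forms V j" "\<And>p. p \<in> forms V j \<Longrightarrow> lookup (contract p F) 0 = f p"
    using functional_form[of f V j, OF f(1,2)] by blast
  have f_I: "p \<in> I" if p: "f p = 0" "p \<in> socle V I" for p
  proof -
    obtain c where c: "p - smult c p0 \<in> I" using soc p(2) by blast
    have "f p = f (p - smult c p0) + f (smult c p0)" by (simp flip: f(1))
    then have "c = 0" using f(2)[of c p0] f(3)[OF c] f(4) p(1) by simp
    with c show ?thesis by (simp add: smult_conv_mult)
  qed
  have "F \<noteq> 0" using F(2)[OF p0(1)] f(4) by auto
  moreover have "I \<subseteq> Ann V F"
  proof (rule graded_ideal_subset[OF gr is_ideal_Ann])
    fix i h assume h: "h \<in> I" "h \<in> forms V i"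
    show "h \<in> Ann V F"
    proof (cases "i \<le> j")
      case True
      have hF: "contract h F \<in> forms V (j - i)" using contract_forms[OF F(1) h(2) True] .
      have "contract h F = 0"
      proof (rule poly_mapping_eqI)
        fix k
        show "lookup (contract h F) k = lookup 0 k"
        proof (cases "keys k \<subseteq> V \<and> mdeg k = j - i")
          case k: True
          have k': "single k (1 :: 'k) \<in> forms V (j - i)" using k by (intro forms_single) auto
          have "lookup (contract h F) k = lookup (contract (single k 1 * h) F) 0"
            by (simp add: contract_mult)
          also have "\<dots> = f (single k 1 * h)"
            using forms_mult[OF k' h(2)] True by (intro F(2)) simp
          also have "\<dots> = 0"
            using is_idealD(4)[OF id h(1)] k' by (intro f(3)) (auto simp: forms_polyring)
          finally show ?thesis by simp
        next
          case False
          then show ?thesis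
            using polyring_lookup[OF forms_polyring[OF hF]] forms_lookup[OF hF] by auto
        qed
      qed
      with h(2) show ?thesis by (simp add: Ann_def forms_polyring)
    next
      case False
      with h(2) contract_high_degree[OF F(1) h(2)] show ?thesis
        by (simp add: Ann_def forms_polyring)
    qed
  qed
  moreover have "Ann V F \<subseteq> I"
  proof (rule graded_ideal_subset[OF graded_ideal_Ann[OF F(1)] id], rule ccontr)
    fix i h assume h: "h \<in> Ann V F" "h \<in> forms V i" "h \<notin> I"
    obtain N where N: "\<And>i. i \<ge> N \<Longrightarrow> forms V i \<subseteq> I" using ar by (auto simp: artinian_def)
    \<comment> \<open>The degrees of counterexamples are bounded since \<open>I\<close> is Artinian,
      so a greatest one exists; multiplying its witness by a variable must land in
      \<open>I\<close>.\<close>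
    define P where "P n \<longleftrightarrow> (\<exists>q. q \<in> Ann V F \<and> q \<in> forms V n \<and> q \<notin> I)" for n
    have "P i" using h by (auto simp: P_def)
    moreover have bd: "n \<le> N" if "P n" for n
      using that N[of n] by (auto simp: P_def) (meson nat_le_linear subsetD)
    ultimately have "P (Greatest P)" and grt: "\<And>n. P n \<Longrightarrow> n \<le> Greatest P"
      using GreatestI_nat[of P i N] Greatest_le_nat[of P _ N] by auto
    then obtain q where q: "q \<in> Ann V F" "q \<in> forms V (Greatest P)" "q \<notin> I"
      by (auto simp: P_def)
    have "Var v * q \<in> I" if "v \<in> V" for v
    proof (rule ccontr)
      assume "Var v * q \<notin> I"
      moreover have "Var v * q \<in> Ann V F"
        using is_idealD(4)[OF is_ideal_Ann q(1)] Var[OF that] by (auto simp: forms_polyring)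
      ultimately have "P (1 + Greatest P)"
        using forms_mult[OF Var[OF that] q(2)] by (auto simp: P_def)
      from grt[OF this] show False by simp
    qed
    then have qs: "q \<in> socle V I" using q(2) by (simp add: socle_def forms_polyring)
    \<comment> \<open>Modulo \<open>I\<close> the socle element \<open>q\<close> is a multiple of
      \<open>p0\<close>, which lives in degree \<open>j\<close>; in any other degree the component
      of \<open>q - smult c p0\<close> is \<open>q\<close> itself, which would then lie in
      \<open>I\<close>.\<close>
    have "Greatest P = j"
    proof (rule ccontr)
      assume ne: "Greatest P \<noteq> j"
      obtain c where "q - smult c p0 \<in> I" using soc[OF qs] by blast
      then have "hcomp (Greatest P) (q - smult c p0) \<in> I" using gr by (simp add: graded_ideal_def)
      then show False using q(3) ne hcomp_form[OF q(2)] hcomp_form[OF p0(1)]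
        by (simp add: hcomp_diff hcomp_smult)
    qed
    then have "f q = lookup (contract q F) 0" using F(2) q(2) by simp
    also have "\<dots> = 0" using q(1) by (simp add: Ann_def)
    finally show False using f_I[OF _ qs] q(3) by blast
  qed
  ultimately show ?thesis using that[OF F(1)] by blast
qed

subsection \<open>Hilbert functions via complementary bases\<close>

lemma independent_Un:
  assumes "finite S" "mp.independent S" "mp.independent B" "mp.span S \<inter> mp.span B = {0}"
  shows "mp.independent (S \<union> B) \<and> S \<inter> B = {}"
  using assms
proof (induct S rule: finite_induct)
  case (insert s S)
  have S: "mp.independent S" "s \<notin> mp.span S"
    using insert.prems(1) insert.hyps(2) by (simp_all add: mp.independent_insert)
  have "mp.span S \<subseteq> mp.span (insert s S)" by (rule mp.span_mono) auto
  then have "mp.span S \<inter> mp.span B = {0}" using insert.prems(3) mp.span_zero by blast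
  then have IH: "mp.independent (S \<union> B)" "S \<inter> B = {}" using insert.hyps(3) S insert.prems by auto
  have "s \<notin> mp.span (S \<union> B)"
  proof
    assume "s \<in> mp.span (S \<union> B)"
    then obtain a b where ab: "s = a + b" "a \<in> mp.span S" "b \<in> mp.span B"
      by (auto simp: mp.span_Un)
    have "s - a \<in> mp.span (insert s S)"
      using ab(2) \<open>mp.span S \<subseteq> mp.span (insert s S)\<close>
      by (intro mp.span_diff) (auto intro: mp.span_base)
    moreover have "s - a = b" using ab(1) by simp
    ultimately have "b = 0" using ab(3) insert.prems(3) by auto
    then show False using ab S(2) by simp
  qed
  then show ?case
    using IH mp.span_base[of s "S \<union> B"] mp.independent_insertI[of s "S \<union> B"] by auto
qed auto

text \<open>Coordinates with respect to \<open>C\<close> are unique, so those of a common vector are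
  supported in both \<open>A\<close> and \<open>B\<close>, that is nowhere.\<close>

lemma span_disjoint_of_independent:
  assumes "mp.independent C" "A \<subseteq> C" "B \<subseteq> C" "A \<inter> B = {}"
  shows "mp.span A \<inter> mp.span B = {0}"
proof -
  have "x = 0" if x: "x \<in> mp.span A" "x \<in> mp.span B" for x
  proof -
    have ind: "mp.independent A" using assms(1,2) mp.independent_mono by blast
    have "mp.representation A x = mp.representation B x"
      using assms x by (metis mp.representation_extend)
    then have "mp.representation A x b = 0" for b
      using mp.representation_ne_zero[of A x b] mp.representation_ne_zero[of B x b] assms(4) by auto
    then show "x = 0"
      using mp.sum_nonzero_representation_eq[OF ind x(1)] by simp
  qed
  then show ?thesis using mp.span_zero by blast
qed

text \<open>For a subspace \<open>U\<close> of \<open>W\<close>, such an \<open>S\<close> maps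
  bijectively to a basis of the quotient of \<open>W\<close> by \<open>U\<close>; its cardinality is
  the codimension, obtained without forming the quotient.\<close>

definition complement_basis :: "'k::field mpoly set \<Rightarrow> 'k mpoly set \<Rightarrow> 'k mpoly set \<Rightarrow> bool" where
  "complement_basis S U W \<longleftrightarrow> finite S \<and> S \<subseteq> W \<and> mp.independent S \<and> mp.span S \<inter> U = {0} \<and>
     (\<forall>w\<in>W. \<exists>a\<in>mp.span S. w - a \<in> U)"

lemma forms_finite_span: "\<exists>T. finite T \<and> card T \<le> card {m. mdeg m = i \<and> keys m \<subseteq> V} \<and>
    (forms V i :: 'k::field mpoly set) \<subseteq> mp.span T"
proof (intro exI conjI)
  let ?S = "{m. mdeg m = i \<and> keys m \<subseteq> V}" and ?f = "\<lambda>m. single m (1::'k)"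
  have fin: "finite ?S" by (rule finite_subset[OF _ finite_mdeg[of i]]) auto
  then show "finite (?f ` ?S)" "card (?f ` ?S) \<le> card ?S"
    by (auto intro: card_image_le)
  show "forms V i \<subseteq> mp.span (?f ` ?S)"
  proof
    fix p :: "'k mpoly" assume "p \<in> forms V i"
    then have "keys p \<subseteq> ?S" by (auto simp: forms_def polyring_def)
    then have "(\<Sum>m\<in>keys p. smult (lookup p m) (single m 1)) \<in> mp.span (?f ` ?S)"
      by (intro mp.span_sum mp.span_scale mp.span_base) auto
    also have "(\<Sum>m\<in>keys p. smult (lookup p m) (single m 1)) = p"
      by (subst (3) mpoly_sum_single) (simp add: smult_single)
    finally show "p \<in> mp.span (?f ` ?S)" .
  qed
qed

lemma independent_finite_forms:
  assumes "mp.independent B" "B \<subseteq> (forms V i :: 'k::field mpoly set)"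
  shows "finite B"
proof -
  obtain T :: "'k mpoly set" where "finite T" "forms V i \<subseteq> mp.span T"
    using forms_finite_span by blast
  then show ?thesis using mp.independent_span_bound[of T B] assms by blast
qed

lemma dim_complement_basis:
  fixes S :: "'k::field mpoly set"
  assumes S: "complement_basis S U (forms V i)" and U: "mp.subspace U" "U \<subseteq> forms V i"
  shows "kdim (forms V i :: 'k mpoly set) = kdim U + card S"
proof -
  obtain B where B: "B \<subseteq> U" "mp.independent B" "U \<subseteq> mp.span B"
    using mp.maximal_independent_subset by blast
  have sB: "mp.span B = U" using mp.span_minimal[OF B(1) U(1)] B(3) by blast
  have "finite B" using independent_finite_forms[OF B(2), of V i] B(1) U(2) by blast
  have *: "mp.independent (S \<union> B) \<and> S \<inter> B = {}"
    using S B(2) sB by (intro independent_Un) (auto simp: complement_basis_def)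
  have "forms V i \<subseteq> mp.span (S \<union> B)"
  proof
    fix w :: "'k mpoly" assume "w \<in> forms V i"
    then obtain a where "a \<in> mp.span S" "w - a \<in> U" using S by (auto simp: complement_basis_def)
    then have "a + (w - a) \<in> mp.span (S \<union> B)"
      unfolding mp.span_Un sB by blast
    then show "w \<in> mp.span (S \<union> B)" by simp
  qed
  moreover have "S \<union> B \<subseteq> forms V i" using S B(1) U(2) by (auto simp: complement_basis_def)
  ultimately have "kdim (forms V i :: 'k mpoly set) = card (S \<union> B)"
    using * mp.basis_card_eq_dim[of "S \<union> B" "forms V i"] by auto
  also have "\<dots> = card S + card B"
    using * S \<open>finite B\<close> by (intro card_Un_disjoint) (auto simp: complement_basis_def)
  also have "card B = kdim U"
    using B by (intro mp.basis_card_eq_dim)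
  finally show ?thesis by simp
qed

lemma complement_basis_exists:
  fixes U :: "'k::field mpoly set"
  assumes U: "mp.subspace U" "U \<subseteq> forms V i"
  obtains S where "complement_basis S U (forms V i)"
proof -
  obtain B where B: "B \<subseteq> U" "mp.independent B" "U \<subseteq> mp.span B"
    using mp.maximal_independent_subset by blast
  have sB: "mp.span B = U" using mp.span_minimal[OF B(1) U(1)] B(3) by blast
  have "B \<subseteq> forms V i" using B(1) U(2) by blast
  then obtain C where C: "B \<subseteq> C" "C \<subseteq> forms V i" "mp.independent C" "forms V i \<subseteq> mp.span C"
    using mp.maximal_independent_subset_extend[OF _ B(2)] by blast
  have "finite C" using independent_finite_forms C by blast
  show ?thesis
  proof
    show "complement_basis (C - B) U (forms V i)"
      unfolding complement_basis_def
    proof (intro conjI ballI)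
      show "mp.independent (C - B)" using C(3) mp.independent_mono by blast
      show "mp.span (C - B) \<inter> U = {0}"
        using span_disjoint_of_independent[OF C(3), of "C - B" B] C(1) sB by blast
      fix w :: "'k mpoly" assume "w \<in> forms V i"
      then have "w \<in> mp.span ((C - B) \<union> B)" using C by (auto simp: Un_absorb2)
      then show "\<exists>a\<in>mp.span (C - B). w - a \<in> U"
        unfolding mp.span_Un sB by force
    qed (use C \<open>finite C\<close> in auto)
  qed
qed

text \<open>\<open>hilb\<close> is a truncated difference of natural numbers; additivity of
  dimension along a complement makes it the true codimension.\<close>

lemma hilb_complement_basis:
  assumes "is_ideal V I" "complement_basis S (I \<inter> forms V i) (forms V i)"
  shows "hilb V I i = card S"
  using dim_complement_basis[OF assms(2)] subspace_ideal[OF assms(1)]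
  by (simp add: hilb_def mp.subspace_inter subspace_forms)

lemma hilb_eq_0_iff:
  assumes "is_ideal V I"
  shows "hilb V I i = 0 \<longleftrightarrow> forms V i \<subseteq> I"
proof -
  obtain S where S: "complement_basis S (I \<inter> forms V i) (forms V i)"
    using complement_basis_exists[of "I \<inter> forms V i" V i] subspace_ideal[OF assms]
    by (auto simp: mp.subspace_inter subspace_forms)
  have "hilb V I i = card S" using assms S by (rule hilb_complement_basis)
  also have "\<dots> = 0 \<longleftrightarrow> S = {}" using S by (auto simp: complement_basis_def)
  also have "\<dots> \<longleftrightarrow> forms V i \<subseteq> I"
  proof
    assume "S = {}"
    then show "forms V i \<subseteq> I" using S by (auto simp: complement_basis_def)
  next
    assume *: "forms V i \<subseteq> I"
    show "S = {}"
    proof (rule ccontr)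
      assume "S \<noteq> {}"
      then obtain s where s: "s \<in> S" by blast
      then have "s \<in> mp.span S \<inter> (I \<inter> forms V i)"
        using * S by (auto simp: complement_basis_def intro: mp.span_base)
      then have "s = 0" using S by (auto simp: complement_basis_def)
      then show False using s S mp.dependent_zero by (auto simp: complement_basis_def)
    qed
  qed
  finally show ?thesis .
qed

text \<open>The monomials bound the dimension of the forms of degree \<open>i\<close> from above, so
  a Hilbert function reaching their number leaves dimension 0 for \<open>I\<close>. This converts
  the values H(1) = 4 and H'(2) = 6 into vanishing statements.\<close>

lemma hilb_full:
  fixes I :: "'k::field mpoly set"
  assumes "is_ideal V I" "card {m. mdeg m = i \<and> keys m \<subseteq> V} \<le> hilb V I i" "p \<in> I" "p \<in> forms V i"
  shows "p = 0"
proof -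
  let ?U = "I \<inter> forms V i"
  obtain T :: "'k mpoly set" where T: "finite T" "card T \<le> card {m. mdeg m = i \<and> keys m \<subseteq> V}" "forms V i \<subseteq> mp.span T"
    using forms_finite_span by blast
  have U: "mp.subspace ?U" "?U \<subseteq> forms V i"
    using subspace_ideal[OF assms(1)] by (auto simp: mp.subspace_inter subspace_forms)
  obtain S where S: "complement_basis S ?U (forms V i)"
    using complement_basis_exists[OF U] .
  have "kdim (forms V i :: 'k mpoly set) = kdim ?U + card S"
    using S U by (rule dim_complement_basis)
  moreover have "kdim (forms V i :: 'k mpoly set) \<le> card T" using T by (intro mp.dim_le_card)
  moreover have "card {m. mdeg m = i \<and> keys m \<subseteq> V} \<le> card S"
    using assms(2) hilb_complement_basis[OF assms(1) S] by simp
  ultimately have 0: "kdim ?U = 0" using T(2) by linarith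
  obtain B where B: "B \<subseteq> ?U" "mp.independent B" "?U \<subseteq> mp.span B"
    using mp.maximal_independent_subset by blast
  have "card B = 0" using mp.basis_card_eq_dim[OF B(1,3,2)] 0 by simp
  moreover have "finite B" using independent_finite_forms B U(2) by blast
  ultimately have "B = {}" by simp
  then show ?thesis using B(3) assms(3,4) by (auto simp: mp.span_empty)
qed

subsection \<open>Setting variables to zero\<close>

definition restrict_vars :: "var set \<Rightarrow> 'k::zero mpoly \<Rightarrow> 'k mpoly" where
  "restrict_vars V p = Abs_poly_mapping (\<lambda>m. if keys m \<subseteq> V then lookup p m else 0)"

lemma lookup_restrict_vars [simp]:
  "lookup (restrict_vars V p) m = (if keys m \<subseteq> V then lookup p m else 0)"
proof -
  have "finite {m. (if keys m \<subseteq> V then lookup p m else 0) \<noteq> 0}"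
    by (rule finite_subset[of _ "keys p"]) (auto simp: in_keys_iff split: if_splits)
  then show ?thesis by (simp add: restrict_vars_def)
qed

lemma restrict_vars_add: "restrict_vars V (p + q) = restrict_vars V p + restrict_vars V q"
  by (intro poly_mapping_eqI) (simp add: lookup_add)

lemma restrict_vars_diff:
  "restrict_vars V (p - q) = restrict_vars V p - restrict_vars V (q :: 'k::comm_ring_1 mpoly)"
  by (intro poly_mapping_eqI) (simp add: lookup_minus)

lemma restrict_vars_smult: "restrict_vars V (smult c p) = smult c (restrict_vars V p)"
  by (intro poly_mapping_eqI) simp

lemma restrict_vars_zero [simp]: "restrict_vars V 0 = 0"
  by (intro poly_mapping_eqI) simp

lemma restrict_vars_single:
  "restrict_vars V (single m c) = (if keys m \<subseteq> V then single m c else 0)"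
  by (intro poly_mapping_eqI) (auto simp: lookup_single when_def)

lemma restrict_vars_id: "p \<in> polyring V \<Longrightarrow> restrict_vars V p = p"
  by (intro poly_mapping_eqI) (simp add: polyring_lookup)

lemma restrict_vars_polyring [simp]: "restrict_vars V p \<in> polyring V"
  by (intro polyringI) simp

lemma restrict_vars_forms: "p \<in> forms U i \<Longrightarrow> restrict_vars V p \<in> forms V i"
  by (intro formsI) (auto simp: forms_lookup)

text \<open>A product of two monomials uses only variables of \<open>V\<close> exactly when both
  factors do, so setting the other variables to zero is a ring homomorphism.\<close>

lemma restrict_vars_mult:
  fixes p :: "'k::comm_ring_1 mpoly"
  shows "restrict_vars V (p * q) = restrict_vars V p * restrict_vars V q"
proof (induct p rule: mpoly_induct)
  case (single m a)
  show ?case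
  proof (induct q rule: mpoly_induct)
    case (single n b)
    show ?case by (auto simp: mult_single restrict_vars_single keys_add_nat)
  qed (auto simp: algebra_simps restrict_vars_add)
qed (auto simp: algebra_simps restrict_vars_add)

lemma contract_restrict_vars:
  assumes "G \<in> polyring V"
  shows "contract h G = contract (restrict_vars V h) G"
proof (induct h rule: mpoly_induct)
  case (single m c)
  then show ?case
    using assms by (intro poly_mapping_eqI) (auto simp: restrict_vars_single polyring_lookup keys_add_nat)
qed (auto simp: contract_add_left restrict_vars_add)

lemma keys_subset_single:
  assumes "keys m \<subseteq> {v}"
  shows "m = single v (mdeg m)"
proof -
  have "m = single v (lookup m v)"
    using assms by (intro poly_mapping_eqI) (auto simp: lookup_single when_def in_keys_iff)
  then show ?thesis by (metis mdeg_single)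
qed

lemma DPow_forms: "v \<in> V \<Longrightarrow> DPow v i \<in> forms V i"
  unfolding DPow_def by (intro forms_single) auto

lemma lookup_DPow: "lookup (DPow v n) m = (if m = single v n then 1 else 0)"
  by (auto simp: DPow_def lookup_single when_def)

text \<open>Among the monomials of degree \<open>i\<close> only the power of \<open>v\<close>
  divides a power of \<open>v\<close>; all others contract it to zero.\<close>

lemma contract_DPow:
  fixes h :: "'k::field mpoly"
  assumes "h \<in> forms U i" "i \<le> j"
  shows "contract h (DPow v j) = smult (lookup h (single v i)) (DPow v (j - i))"
proof (induct h rule: mpoly_induct)
  case (single m c)
  have "mdeg m = i" using single assms(1) by (simp add: forms_def)
  have sj: "single v j = single v i + single v (j - i)"
    using assms(2) by (simp flip: single_add)
  show ?case
  proof (cases "m = single v i")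
    case True
    have "m + k = single v j \<longleftrightarrow> k = single v (j - i)" for k
      unfolding True sj by simp
    then show ?thesis by (intro poly_mapping_eqI) (simp add: True lookup_DPow)
  next
    case False
    have "m + k \<noteq> single v j" for k
    proof
      assume "m + k = single v j"
      then have "keys m \<subseteq> {v}" using keys_add_nat[of m k] by (auto split: if_splits)
      then show False using False keys_subset_single \<open>mdeg m = i\<close> by blast
    qed
    then show ?thesis using False
      by (intro poly_mapping_eqI) (simp add: lookup_DPow lookup_single_not_eq)
  qed
qed (auto simp: contract_add_left lookup_add mp.scale_left_distrib)

section \<open>Mixed monomials and normal forms modulo wx, wy, wz\<close>

lemma mixed_monomial:
  assumes "\<not> keys m \<subseteq> R'vars" "m \<noteq> single vW (mdeg m)"
  obtains v k where "v \<in> R'vars" "m = single vW 1 + single v 1 + k"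
proof -
  have "\<not> keys m \<subseteq> {vW}" using assms(2) keys_subset_single by blast
  then obtain v where v: "v \<in> keys m" "v \<noteq> vW" by blast
  obtain u where "u \<in> keys m" "u \<notin> R'vars" using assms(1) by blast
  then have W: "vW \<in> keys m" by (cases u) (auto simp: R'vars_def)
  \<comment> \<open>The truncated subtraction is exact here: \<open>vW\<close> and \<open>v\<close>
    are distinct and both occur in \<open>m\<close>.\<close>
  have "m = single vW 1 + single v 1 + (m - (single vW 1 + single v 1))"
    using v W by (intro poly_mapping_eqI) (auto simp: lookup_add lookup_minus lookup_single when_def in_keys_iff)
  moreover have "v \<in> R'vars" using v(2) by (cases v) (auto simp: R'vars_def)
  ultimately show ?thesis using that by blast
qed

abbreviation wxyz :: "'k::comm_ring_1 mpoly set" where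
  "wxyz \<equiv> {Var vW * Var vX, Var vW * Var vY, Var vW * Var vZ}"

lemma wxyz_iff: "b \<in> wxyz \<longleftrightarrow> (\<exists>v\<in>R'vars. b = single (single vW 1 + single v 1) 1)"
  by (auto simp: R'vars_def Var_def mult_single)

lemma wxyz_forms: "b \<in> wxyz \<Longrightarrow> b \<in> forms UNIV 2"
  unfolding wxyz_iff by (auto intro!: forms_single)

lemma vW_notin_R' [simp]: "vW \<notin> R'vars"
  by (simp add: R'vars_def)

lemma restrict_wxyz: "b \<in> wxyz \<Longrightarrow> restrict_vars R'vars b = 0"
  unfolding wxyz_iff by (auto simp: restrict_vars_single keys_add_nat)

text \<open>Every mixed monomial is a multiple of a generator, so h(0,x,y,z) plus the pure power of
  w is a normal form. In degree 0 the constant monomial would be counted both as a monomial in x, y,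
  z and as a power of w, hence \<open>i \<ge> 1\<close>.\<close>

lemma mod_wxyz:
  fixes h :: "'k::field mpoly"
  assumes "h \<in> forms UNIV i" "i \<ge> 1"
  shows "h - restrict_vars R'vars h - smult (lookup h (single vW i)) (DPow vW i) \<in> ideal_gen UNIV wxyz"
proof (induct h rule: mpoly_induct)
  note id = is_ideal_ideal_gen[of "wxyz :: 'k mpoly set" UNIV, simplified]
  case zero
  show ?case using is_idealD(2)[OF id] by simp
next
  note id = is_ideal_ideal_gen[of "wxyz :: 'k mpoly set" UNIV, simplified]
  case (single m c)
  have deg: "mdeg m = i" using single assms(1) by (simp add: forms_def)
  show ?case
  proof (cases "keys m \<subseteq> R'vars \<or> m = single vW i")
    case True
    then have "single m c - restrict_vars R'vars (single m c)
        - smult (lookup (single m c) (single vW i)) (DPow vW i) = 0"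
      using assms(2) by (auto simp: restrict_vars_single DPow_def smult_single lookup_single when_def)
    then show ?thesis using is_idealD(2)[OF id] by simp
  next
    case False
    then obtain v k where vk: "v \<in> R'vars" "m = single vW 1 + single v 1 + k"
      using mixed_monomial[of m] deg by blast
    then have "single m c = single k c * single (single vW 1 + single v 1) 1"
      by (simp add: mult_single add_ac)
    moreover have "single (single vW 1 + single v 1) 1 \<in> (wxyz :: 'k mpoly set)"
      using vk(1) unfolding wxyz_iff by blast
    then have "single (single vW 1 + single v 1) 1 \<in> ideal_gen UNIV (wxyz :: 'k mpoly set)"
      by (rule subsetD[OF ideal_gen_superset])
    ultimately have "single m c \<in> ideal_gen UNIV wxyz"
      by (simp only:) (rule is_idealD(4)[OF id], simp_all)
    then show ?thesis using False by (simp add: restrict_vars_single lookup_single_not_eq)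
  qed
next
  note id = is_ideal_ideal_gen[of "wxyz :: 'k mpoly set" UNIV, simplified]
  case (add p q)
  have "p + q - restrict_vars R'vars (p + q) - smult (lookup (p + q) (single vW i)) (DPow vW i)
    = (p - restrict_vars R'vars p - smult (lookup p (single vW i)) (DPow vW i))
    + (q - restrict_vars R'vars q - smult (lookup q (single vW i)) (DPow vW i))"
    unfolding restrict_vars_add lookup_add mp.scale_left_distrib by (simp only: algebra_simps)
  also have "\<dots> \<in> ideal_gen UNIV wxyz" using add by (rule is_idealD(3)[OF id])
  finally show ?case .
qed

lemma contract_wxyz:
  assumes "b \<in> wxyz"
  shows "G \<in> polyring R'vars \<Longrightarrow> contract b G = 0" "contract b (DPow vW j) = 0"
proof -
  from assms obtain v where v: "v \<in> R'vars" "b = single (single vW 1 + single v 1) 1"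
    unfolding wxyz_iff by blast
  show "contract b G = 0" if "G \<in> polyring R'vars"
    using that by (intro poly_mapping_eqI) (simp add: v(2) polyring_lookup keys_add_nat)
  have "single vW 1 + single v 1 + k \<noteq> single vW j" for k
  proof
    assume "single vW 1 + single v 1 + k = single vW j"
    then have "lookup (single vW 1 + single v 1 + k) v = lookup (single vW j) v" by simp
    moreover have "vW \<noteq> v" using v(1) by auto
    ultimately show False by (simp add: lookup_add lookup_single when_def)
  qed
  then show "contract b (DPow vW j) = 0"
    by (intro poly_mapping_eqI) (simp add: v(2) lookup_DPow)
qed

text \<open>The coefficient of \<open>H\<close> at a mixed monomial is a coefficient of the
  contraction of \<open>H\<close> by one of wx, wy, wz, so it vanishes.\<close>

lemma decompose_of_contract_wxyz:
  fixes H :: "'k::field mpoly"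
  assumes "H \<in> forms UNIV j" "j \<ge> 1" "\<And>b. b \<in> wxyz \<Longrightarrow> contract b H = 0"
  shows "H = restrict_vars R'vars H + smult (lookup H (single vW j)) (DPow vW j)"
proof (rule poly_mapping_eqI)
  fix m
  have "lookup H m = 0" if "\<not> keys m \<subseteq> R'vars" "m \<noteq> single vW j"
  proof (cases "mdeg m = j")
    case True
    then obtain v k where vk: "v \<in> R'vars" "m = single vW 1 + single v 1 + k"
      using mixed_monomial[of m] \<open>\<not> keys m \<subseteq> R'vars\<close> \<open>m \<noteq> single vW j\<close> by blast
    have "single (single vW 1 + single v 1) 1 \<in> (wxyz :: 'k mpoly set)"
      using vk(1) unfolding wxyz_iff by blast
    then have "lookup (contract (single (single vW 1 + single v 1) 1) H) k = 0"
      by (subst assms(3)) auto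
    then show ?thesis by (simp add: vk(2))
  next
    case False
    then show ?thesis by (rule forms_lookup[OF assms(1)])
  qed
  then show "lookup H m = lookup (restrict_vars R'vars H + smult (lookup H (single vW j)) (DPow vW j)) m"
    using assms(2) by (auto simp: lookup_add lookup_DPow)
qed

lemma perp_wxyz:
  assumes "j \<ge> 1"
  shows "perp UNIV (ideal_gen UNIV (wxyz :: 'k::field mpoly set)) \<inter> forms UNIV j
     = kspan (forms R'vars j \<union> {DPow vW j})"
proof
  show "perp UNIV (ideal_gen UNIV (wxyz :: 'k mpoly set)) \<inter> forms UNIV j
     \<subseteq> kspan (forms R'vars j \<union> {DPow vW j})"
  proof
    fix H :: "'k mpoly"
    assume H: "H \<in> perp UNIV (ideal_gen UNIV wxyz) \<inter> forms UNIV j"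
    then have "H = restrict_vars R'vars H + smult (lookup H (single vW j)) (DPow vW j)"
      using assms ideal_gen_superset[of wxyz UNIV]
      by (intro decompose_of_contract_wxyz) (auto simp: perp_def)
    moreover have "restrict_vars R'vars H \<in> forms R'vars j"
      using H restrict_vars_forms by blast
    ultimately show "H \<in> kspan (forms R'vars j \<union> {DPow vW j})"
      by (metis mp.span_add mp.span_scale mp.span_base UnI1 UnI2 singletonI)
  qed
  have "contract p H = 0" if "p \<in> ideal_gen UNIV wxyz" "H \<in> forms R'vars j \<union> {DPow vW j}"
    for p H :: "'k mpoly"
  proof -
    have "ideal_gen UNIV wxyz \<subseteq> Ann UNIV H"
      using that(2) contract_wxyz by (intro ideal_gen_subset_Ann) (auto simp: forms_polyring)
    with that(1) show ?thesis by (auto simp: Ann_def)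
  qed
  then have "forms R'vars j \<union> {DPow vW j} \<subseteq> perp UNIV (ideal_gen UNIV wxyz) \<inter> (forms UNIV j :: 'k mpoly set)"
    by (auto simp: perp_def DPow_forms intro: forms_mono[of R'vars UNIV])
  moreover have "mp.subspace (perp UNIV (ideal_gen UNIV wxyz) \<inter> (forms UNIV j :: 'k mpoly set))"
    by (intro mp.subspace_inter subspace_forms)
       (auto simp: mp.subspace_def perp_def contract_add_right contract_smult_right)
  ultimately show "kspan (forms R'vars j \<union> {DPow vW j})
      \<subseteq> perp UNIV (ideal_gen UNIV (wxyz :: 'k mpoly set)) \<inter> forms UNIV j"
    by (rule mp.span_minimal)
qed

lemma lookup_single_vW: "p \<in> polyring R'vars \<Longrightarrow> i \<ge> 1 \<Longrightarrow> lookup p (single vW i) = 0"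
  by (auto intro: polyring_lookup)

text \<open>Only the component of degree \<open>j - i\<close> of a multiplier contributes to degree
  \<open>i\<close>, so the multiplier may be replaced by a form.\<close>

lemma orbit_forms:
  assumes "H \<in> act_orbit V E" "H \<in> forms U i" "E \<in> forms U' j" "i \<le> j"
  shows "\<exists>r\<in>forms V (j - i). H = contract r E"
proof -
  obtain h where h: "h \<in> polyring V" "H = contract h E" using assms(1) by (auto simp: act_orbit_def)
  have "H = hcomp i (contract h E)" using hcomp_form[OF assms(2), of i] h(2) by simp
  also have "\<dots> = contract (hcomp (j - i) h) E" using assms(4) by (simp add: hcomp_contract[OF assms(3)])
  finally show ?thesis using forms_hcomp[OF h(1)] by blast
qed

subsection \<open>Connected sums\<close>

text \<open>The algebra with dual generator \<open>F\<close> below is the connected sum of the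
  quotient of R' by \<open>J\<close> and K[w]/(w^(j+1)), glued along their socles. Conditions on
  \<open>J\<close> in degrees 1 and 2 enter later, through nested contexts.\<close>

locale connected_sum =
  fixes G :: "'k::field mpoly" and \<alpha> :: 'k and j :: nat
  assumes G: "G \<in> forms R'vars j" and G0: "G \<noteq> 0" and \<alpha>0: "\<alpha> \<noteq> 0" and j1: "j \<ge> 1"
begin

definition F :: "'k mpoly" where
  "F = G + smult \<alpha> (DPow vW j)"

abbreviation I :: "'k mpoly set" where "I \<equiv> Ann UNIV F"
abbreviation J :: "'k mpoly set" where "J \<equiv> Ann R'vars G"

lemma F_forms: "F \<in> forms UNIV j"
  unfolding F_def using G by (intro forms_add forms_smult DPow_forms forms_mono[of R'vars UNIV]) auto

lemma id_I: "is_ideal UNIV I" and id_J: "is_ideal R'vars J"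
  by (rule is_ideal_Ann)+

lemma contract_F:
  assumes "h \<in> forms UNIV i" "i \<le> j"
  shows "contract h F = contract (restrict_vars R'vars h) G
    + smult (\<alpha> * lookup h (single vW i)) (DPow vW (j - i))"
  using contract_restrict_vars[OF forms_polyring[OF G], of h] assms
  by (simp add: F_def contract_add_right contract_smult_right contract_DPow mult.commute)

text \<open>For \<open>i < j\<close> the monomial W^[j-i] is not constant, hence absent from
  contractions of \<open>G\<close>, and the two summands of \<open>contract_F\<close> cannot cancel.
  At \<open>i = j\<close> both are constants and can cancel, which is where w^j - g arises.\<close>

lemma I_iff:
  assumes "h \<in> forms UNIV i" "1 \<le> i" "i < j"
  shows "h \<in> I \<longleftrightarrow> restrict_vars R'vars h \<in> J \<and> lookup h (single vW i) = 0"
proof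
  assume "h \<in> I"
  then have 0: "contract (restrict_vars R'vars h) G
      + smult (\<alpha> * lookup h (single vW i)) (DPow vW (j - i)) = 0"
    using contract_F[OF assms(1)] assms(3) by (simp add: Ann_def)
  from arg_cong[OF this, of "\<lambda>p. lookup p (single vW (j - i))"]
  have "\<alpha> * lookup h (single vW i) = 0"
    using polyring_contract[OF forms_polyring[OF G]] assms(3)
    by (simp add: lookup_add lookup_single_vW lookup_DPow)
  then have "lookup h (single vW i) = 0" using \<alpha>0 by simp
  with 0 show "restrict_vars R'vars h \<in> J \<and> lookup h (single vW i) = 0"
    by (simp add: Ann_def)
next
  assume "restrict_vars R'vars h \<in> J \<and> lookup h (single vW i) = 0"
  then show "h \<in> I" using contract_F[OF assms(1)] assms(3) by (simp add: Ann_def)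
qed

lemma F0: "F \<noteq> 0"
proof
  assume "F = 0"
  then have "lookup F (single vW j) = 0" by simp
  then show False
    using lookup_single_vW[OF forms_polyring[OF G]] j1 \<alpha>0 by (simp add: F_def lookup_add lookup_DPow)
qed

lemma I_0: "h \<in> I \<Longrightarrow> h \<in> forms UNIV 0 \<Longrightarrow> h = 0"
proof -
  assume h: "h \<in> I" "h \<in> forms UNIV 0"
  have "contract (single 0 (lookup h 0)) F = 0"
    using h(1) by (simp add: Ann_def flip: forms_0[OF h(2)])
  then have "lookup h 0 = 0"
    using F0 unfolding contract_constant_term by simp
  then show "h = 0" using forms_0[OF h(2)] by simp
qed

text \<open>A form in x, y, z of degree between 1 and \<open>j\<close> kills W^[j], so it contracts
  \<open>F\<close> and \<open>G\<close> alike. A constant annihilates \<open>F\<close> or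
  \<open>G\<close> only if it is zero, and above degree \<open>j\<close> everything annihilates
  both.\<close>

lemma R'_subset_I_iff:
  assumes "h \<in> forms R'vars i"
  shows "h \<in> I \<longleftrightarrow> h \<in> J"
proof (cases "i = 0 \<or> j < i")
  case True
  then show ?thesis
  proof
    assume "i = 0"
    have *: "h = single 0 (lookup h 0)" using assms \<open>i = 0\<close> forms_0 by blast
    have "contract h F = smult (lookup h 0) F" "contract h G = smult (lookup h 0) G"
      by (subst *, rule contract_constant_term)+
    then show ?thesis using F0 G0 assms by (simp add: Ann_def forms_polyring)
  next
    assume "j < i"
    then show ?thesis using contract_high_degree[OF G assms] contract_high_degree[OF F_forms assms]
      assms by (simp add: Ann_def forms_polyring)
  qed
next
  case False
  have "h \<in> forms UNIV i" using assms forms_mono by blast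
  then have "contract h F = contract h G"
    using contract_F[of h i] False assms
    by (simp add: lookup_single_vW restrict_vars_id forms_polyring)
  then show ?thesis using assms by (simp add: Ann_def forms_polyring)
qed

lemma I_inter_R': "I \<inter> polyring R'vars = J"
proof -
  have "p \<in> I \<longleftrightarrow> p \<in> J" if p: "p \<in> polyring R'vars" for p
  proof -
    have 1: "hcomp i p \<in> I \<longleftrightarrow> hcomp i p \<in> J" for i
      by (rule R'_subset_I_iff[OF forms_hcomp[OF p]])
    have "p \<in> A \<longleftrightarrow> (\<forall>i. hcomp i p \<in> A)" if "graded_ideal V A" for V A
    proof
      assume "\<forall>i. hcomp i p \<in> A"
      then show "p \<in> A"
        using that by (subst mpoly_sum_hcomp) (auto simp: graded_ideal_def intro: is_ideal_sum)
    qed (use that in \<open>auto simp: graded_ideal_def\<close>)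
    from this[OF graded_ideal_Ann[OF F_forms]] this[OF graded_ideal_Ann[OF G]] 1
    show ?thesis by metis
  qed
  moreover have "J \<subseteq> polyring R'vars" by (auto simp: Ann_def)
  ultimately show ?thesis by blast
qed

lemma wxyz_I: "wxyz \<subseteq> I"
proof
  fix b :: "'k mpoly" assume "b \<in> wxyz"
  then have "contract b F = 0"
    using contract_wxyz[of b] forms_polyring[OF G]
    by (simp only: F_def contract_add_right contract_smult_right) simp
  then show "b \<in> I" by (simp add: Ann_def)
qed

lemma obtain_g:
  obtains g where "g \<in> forms R'vars j" "contract g G = single 0 \<alpha>"
proof -
  from G0 obtain m where m: "lookup G m \<noteq> 0"
    by (metis lookup_zero poly_mapping_eqI)
  have mV: "keys m \<subseteq> R'vars" "mdeg m = j"
    using m polyring_lookup[OF forms_polyring[OF G], of m] forms_lookup[OF G, of m] by auto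
  \<comment> \<open>A monomial of \<open>G\<close>, scaled so that it contracts \<open>G\<close> to
    the same constant \<alpha> to which w^j contracts \<open>F\<close>.\<close>
  define g where "g = single m (\<alpha> / lookup G m)"
  have gj: "g \<in> forms R'vars j" unfolding g_def using mV by (rule forms_single)
  moreover have "contract g G = single 0 \<alpha>"
    using contract_constant[OF G gj] m by (simp add: g_def)
  ultimately show ?thesis by (rule that)
qed

context
  fixes g assumes g: "g \<in> forms R'vars j" and gG: "contract g G = single 0 \<alpha>"
begin

lemma g0: "g \<noteq> 0" using gG \<alpha>0 by (metis contract_zero_left single_zero inj_single injD)

lemma g_notin_J: "g \<notin> J" using gG \<alpha>0 by (simp add: Ann_def) (metis single_zero inj_single injD)

lemma g_UNIV: "g \<in> forms UNIV j"
  using g forms_mono by blast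

lemma w_g_I: "DPow vW j - g \<in> I"
proof -
  have "contract (DPow vW j) F = single 0 \<alpha>"
    using contract_F[OF DPow_forms[of vW UNIV j]]  j1
    by (simp add: DPow_def restrict_vars_single smult_conv_mult)
  moreover have "contract g F = single 0 \<alpha>"
    using contract_F[OF g_UNIV] g gG j1
    by (simp add: lookup_single_vW restrict_vars_id forms_polyring)
  ultimately show ?thesis by (simp add: Ann_def contract_diff_left)
qed

text \<open>Modulo wx, wy, wz a form of \<open>I\<close> is h(0,x,y,z) + c w^i, so only this sum has
  to be generated. The three cases handle c w^i: it is absent below degree \<open>j\<close>,
  replaced by c g in degree \<open>j\<close>, and itself generated above degree
  \<open>j\<close>.\<close>

lemma I_generators: "I = ideal_gen UNIV (J \<union> (wxyz \<union> {DPow vW j - g}))"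
proof
  let ?L = "ideal_gen UNIV (J \<union> (wxyz \<union> {DPow vW j - g}))"
  have id: "is_ideal UNIV ?L" by (rule is_ideal_ideal_gen) simp
  show LI: "?L \<subseteq> I"
    using w_g_I I_inter_R' wxyz_I by (intro ideal_gen_least[OF id_I]) auto
  have sup: "J \<subseteq> ?L" "wxyz \<subseteq> ?L" "DPow vW j - g \<in> ?L"
    using ideal_gen_superset[of "J \<union> (wxyz \<union> {DPow vW j - g})" UNIV] by auto
  then have wL: "ideal_gen UNIV wxyz \<subseteq> ?L" by (intro ideal_gen_least[OF id])
  show "I \<subseteq> ?L"
  proof (rule graded_ideal_subset[OF graded_ideal_Ann[OF F_forms] id])
    fix i h assume h: "h \<in> I" "h \<in> forms UNIV i"
    show "h \<in> ?L"
    proof (cases "i = 0")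
      case True
      then show ?thesis using I_0 h is_idealD(2)[OF id] by auto
    next
      case i: False
      let ?c = "lookup h (single vW i)"
      define r where "r = h - restrict_vars R'vars h - smult ?c (DPow vW i)"
      have rL: "r \<in> ?L" unfolding r_def using mod_wxyz[OF h(2)] i wL by auto
      have h_eq: "h = r + (restrict_vars R'vars h + smult ?c (DPow vW i))" by (simp add: r_def)
      consider "i < j" | "i = j" | "i > j" by linarith
      then have "restrict_vars R'vars h + smult ?c (DPow vW i) \<in> ?L"
      proof cases
        case 1
        then show ?thesis using I_iff[OF h(2)] h(1) i sup(1) by auto
      next
        case 2
        \<comment> \<open>Trading c w^j for c g leaves an element of \<open>I\<close> in x, y, z
          alone, hence of \<open>J\<close>; the difference \<open>s\<close> is a multiple of the
          last generator.\<close>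
        define q where "q = restrict_vars R'vars h + smult ?c g"
        define s where "s = smult ?c (DPow vW j - g)"
        have s: "s \<in> ?L" unfolding s_def using sup(3) by (rule is_ideal_smult[OF id])
        have qs: "restrict_vars R'vars h + smult ?c (DPow vW i) = q + s"
          by (simp add: q_def s_def \<open>i = j\<close> mp.scale_right_diff_distrib)
        then have "h = r + (q + s)" using h_eq by (simp only:)
        then have "q = h - r - s" by simp
        moreover have "h - r - s \<in> I"
          using h(1) rL s LI by (intro is_ideal_diff[OF id_I]) auto
        moreover have "q \<in> polyring R'vars"
          unfolding q_def using g by (intro polyring_add polyring_smult) (auto simp: forms_polyring)
        ultimately have "q \<in> ?L" using I_inter_R' sup(1) by blast
        with s show ?thesis unfolding qs by (intro is_idealD(3)[OF id])
      next
        case 3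
        have "restrict_vars R'vars h \<in> J"
          using restrict_vars_forms[OF h(2)] contract_high_degree[OF G _ 3] by (auto simp: Ann_def)
        moreover have "DPow vW i \<in> ?L"
        proof -
          \<comment> \<open>The second summand w^(i-j) g is generated by wx, wy, wz: its restriction
            to w = 0 vanishes, and it has no pure power of w because \<open>g\<close> has positive
            degree in x, y, z.\<close>
          have eq: "DPow vW i = DPow vW (i - j) * (DPow vW j - g) + DPow vW (i - j) * g"
            using 3 by (simp add: algebra_simps) (simp add: DPow_def mult_single flip: single_add)
          have gi: "DPow vW (i - j) * g \<in> forms UNIV i"
            using forms_mult[OF DPow_forms[of vW UNIV "i - j"] g_UNIV] 3 by simp
          have "restrict_vars R'vars (DPow vW (i - j)) = (0 :: 'k mpoly)"
            using 3 by (simp add: DPow_def restrict_vars_single)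
          then have r0: "restrict_vars R'vars (DPow vW (i - j) * g) = 0"
            by (simp add: restrict_vars_mult)
          have "single vW i = single vW (i - j) + single vW j"
            using 3 by (simp flip: single_add)
          then have "lookup (DPow vW (i - j) * g) (single vW i) = lookup g (single vW j)"
            by (simp add: DPow_def lookup_single_mult)
          also have "\<dots> = 0" using g j1 by (simp add: lookup_single_vW forms_polyring)
          finally have "DPow vW (i - j) * g \<in> ?L"
            using mod_wxyz[OF gi] r0 i wL by auto
          moreover have "DPow vW (i - j) * (DPow vW j - g) \<in> ?L"
            using sup(3) by (intro is_idealD(4)[OF id]) auto
          ultimately show ?thesis by (subst eq) (rule is_idealD(3)[OF id])
        qed
        ultimately show ?thesis
          using sup(1) by (intro is_idealD(3)[OF id] is_ideal_smult[OF id]) auto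
      qed
      then show ?thesis by (subst h_eq) (rule is_idealD(3)[OF id rL])
    qed
  qed
qed

end

text \<open>In these degrees w adds nothing to the quotient: constants already lie in R', w^j is
  congruent to \<open>g\<close>, and above degree \<open>j\<close> every form lies in
  \<open>I\<close>.\<close>

lemma R'_mod_I:
  assumes h: "h \<in> forms UNIV i" and i: "i = 0 \<or> i \<ge> j"
  obtains h' where "h' \<in> forms R'vars i" "h - h' \<in> I"
proof (cases "i = 0")
  case True
  have "h = single 0 (lookup h 0)" using h True forms_0 by blast
  also have "\<dots> \<in> polyring R'vars" by (rule polyring_single) simp
  finally have "h = restrict_vars R'vars h" by (simp add: restrict_vars_id)
  then have "h - restrict_vars R'vars h \<in> I" using is_idealD(2)[OF id_I] by simp
  then show ?thesis using that restrict_vars_forms[OF h] by blast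
next
  case False
  then have "i \<ge> j" using i by simp
  obtain g where g: "g \<in> forms R'vars j" "contract g G = single 0 \<alpha>" by (rule obtain_g)
  show ?thesis
  proof (cases "i = j")
    case True
    let ?c = "lookup h (single vW i)"
    let ?h' = "restrict_vars R'vars h + smult ?c g"
    have "h - restrict_vars R'vars h - smult ?c (DPow vW i) \<in> I"
      using mod_wxyz[OF h] False ideal_gen_least[OF id_I wxyz_I] by auto
    moreover have "smult ?c (DPow vW j - g) \<in> I"
      using w_g_I[OF g] is_ideal_smult[OF id_I] by blast
    ultimately have "h - restrict_vars R'vars h - smult ?c (DPow vW i) + smult ?c (DPow vW j - g) \<in> I"
      by (rule is_idealD(3)[OF id_I])
    also have "h - restrict_vars R'vars h - smult ?c (DPow vW i) + smult ?c (DPow vW j - g) = h - ?h'"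
      by (simp add: True mp.scale_right_diff_distrib algebra_simps)
    finally have "h - ?h' \<in> I" .
    moreover have "?h' \<in> forms R'vars i"
      using True g(1) h by (intro forms_add forms_smult restrict_vars_forms) auto
    ultimately show ?thesis using that by blast
  next
    case False
    then have "h - 0 \<in> I" using \<open>i \<ge> j\<close> contract_high_degree[OF F_forms h] by (simp add: Ann_def)
    then show ?thesis using that[of 0] by simp
  qed
qed

text \<open>A basis \<open>S\<close> of a complement of \<open>J\<close> in degree \<open>i\<close>
  also serves for \<open>I\<close>, enlarged by w^i exactly when 1 <= i <= j-1.\<close>

lemma hilb_I: "hilb UNIV I i = hilb R'vars J i + (if 1 \<le> i \<and> i \<le> j - 1 then 1 else 0)"
proof -
  obtain S where S: "complement_basis S (J \<inter> forms R'vars i) (forms R'vars i)"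
    using complement_basis_exists[of "J \<inter> forms R'vars i" R'vars i] subspace_ideal[OF id_J]
    by (auto simp: mp.subspace_inter subspace_forms)
  have fS: "finite S" "S \<subseteq> forms R'vars i" "mp.independent S" "mp.span S \<inter> (J \<inter> forms R'vars i) = {0}"
    using S by (auto simp: complement_basis_def)
  have SR: "mp.span S \<subseteq> forms R'vars i"
    using fS(2) by (intro mp.span_minimal subspace_forms)
  have SI: "q = 0" if "q \<in> mp.span S" "q \<in> I" for q
  proof -
    have "q \<in> forms R'vars i" using SR that(1) by blast
    then have "q \<in> J" using that(2) R'_subset_I_iff by blast
    then show ?thesis using fS(4) that(1) \<open>q \<in> forms R'vars i\<close> by blast
  qed
  have RU: "forms R'vars i \<subseteq> (forms UNIV i :: 'k mpoly set)" using forms_mono by blast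
  show ?thesis
  proof (cases "1 \<le> i \<and> i \<le> j - 1")
    case i: True
    then have i': "1 \<le> i" "i < j" using j1 by auto
    let ?D = "DPow vW i :: 'k mpoly"
    have lR: "lookup q (single vW i) = 0" if "q \<in> forms R'vars i" for q :: "'k mpoly"
      using lookup_single_vW[OF forms_polyring[OF that]] i' by blast
    have "?D \<notin> mp.span S" using SR lR[of ?D] by (auto simp: lookup_DPow)
    then have "?D \<notin> S" using mp.span_base by blast
    have "complement_basis (insert ?D S) (I \<inter> forms UNIV i) (forms UNIV i)"
      unfolding complement_basis_def
    proof (intro conjI ballI)
      show "finite (insert ?D S)" using fS(1) by simp
      show "insert ?D S \<subseteq> forms UNIV i" using fS(2) RU DPow_forms[of vW UNIV i] by auto
      show "mp.independent (insert ?D S)"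
        using \<open>?D \<notin> mp.span S\<close> fS(3) by (rule mp.independent_insertI)
      have "p = 0" if p: "p \<in> mp.span (insert ?D S)" "p \<in> I" "p \<in> forms UNIV i" for p
      proof -
        \<comment> \<open>The coefficient of w^i detects the multiple of \<open>?D\<close>: it
          vanishes on \<open>I\<close> by \<open>I_iff\<close> and on the span of \<open>S\<close>,
          so \<open>k = 0\<close>.\<close>
        obtain k where k: "p - smult k ?D \<in> mp.span S"
          using p(1) by (auto simp: mp.span_insert)
        have "lookup p (single vW i) = 0" using I_iff[OF p(3) i'] p(2) by blast
        moreover have "lookup (p - smult k ?D) (single vW i) = 0" using k SR by (intro lR) blast
        ultimately have "k = 0" by (simp add: lookup_minus lookup_DPow)
        with k have "p \<in> mp.span S" by simp
        then show ?thesis using SI p(2) by blast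
      qed
      then show "mp.span (insert ?D S) \<inter> (I \<inter> forms UNIV i) = {0}"
        using mp.span_zero is_idealD(2)[OF id_I] by auto
      fix h :: "'k mpoly" assume h: "h \<in> forms UNIV i"
      obtain a where a: "a \<in> mp.span S" "restrict_vars R'vars h - a \<in> J"
        using S restrict_vars_forms[OF h, of R'vars] unfolding complement_basis_def by blast
      let ?b = "a + smult (lookup h (single vW i)) ?D"
      have aR: "a \<in> forms R'vars i" using a(1) SR by blast
      have fb: "h - ?b \<in> forms UNIV i"
        using h aR RU by (intro forms_diff forms_add forms_smult DPow_forms) auto
      have "restrict_vars R'vars (h - ?b) = restrict_vars R'vars h - a"
        using aR i'
        by (simp add: restrict_vars_diff restrict_vars_add restrict_vars_smult restrict_vars_id
            forms_polyring DPow_def restrict_vars_single)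
      moreover have "lookup (h - ?b) (single vW i) = 0"
        using lR[OF aR] by (simp add: lookup_minus lookup_add lookup_DPow)
      ultimately have "h - ?b \<in> I" using I_iff[OF fb i'] a(2) by simp
      moreover have "?b \<in> mp.span (insert ?D S)"
      proof (rule mp.span_add)
        show "a \<in> mp.span (insert ?D S)" using a(1) mp.span_mono[of S "insert ?D S"] by blast
        show "smult (lookup h (single vW i)) ?D \<in> mp.span (insert ?D S)"
          by (intro mp.span_scale mp.span_base) simp
      qed
      ultimately show "\<exists>a\<in>mp.span (insert ?D S). h - a \<in> I \<inter> forms UNIV i" using fb by blast
    qed
    then have "hilb UNIV I i = card (insert ?D S)" by (rule hilb_complement_basis[OF id_I])
    then show ?thesis
      using hilb_complement_basis[OF id_J S] fS(1) \<open>?D \<notin> S\<close> i by simp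
  next
    case False
    then have i: "i = 0 \<or> i \<ge> j" by linarith
    have "complement_basis S (I \<inter> forms UNIV i) (forms UNIV i)"
      unfolding complement_basis_def
    proof (intro conjI ballI fS(1,3))
      show "S \<subseteq> forms UNIV i" using fS(2) RU by blast
      show "mp.span S \<inter> (I \<inter> forms UNIV i) = {0}"
        using SI mp.span_zero is_idealD(2)[OF id_I] by auto
      fix h :: "'k mpoly" assume h: "h \<in> forms UNIV i"
      obtain h' where h': "h' \<in> forms R'vars i" "h - h' \<in> I" using R'_mod_I[OF h i] .
      obtain a where a: "a \<in> mp.span S" "h' - a \<in> J"
        using S h'(1) unfolding complement_basis_def by blast
      have "(h - h') + (h' - a) \<in> I" using h'(2) a(2) I_inter_R' by (intro is_idealD(3)[OF id_I]) auto
      moreover have "h - a \<in> forms UNIV i" using h a(1) SR RU by (intro forms_diff) auto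
      ultimately show "\<exists>a\<in>mp.span S. h - a \<in> I \<inter> forms UNIV i" using a(1) by auto
    qed
    then have "hilb UNIV I i = card S" by (rule hilb_complement_basis[OF id_I])
    then show ?thesis using hilb_complement_basis[OF id_J S] False by simp
  qed
qed

lemma perp_I_j: "perp UNIV I \<inter> forms UNIV j = kspan {F}"
proof
  show "perp UNIV I \<inter> forms UNIV j \<subseteq> kspan {F}"
  proof
    fix H :: "'k mpoly" assume "H \<in> perp UNIV I \<inter> forms UNIV j"
    then have "\<exists>r\<in>forms UNIV (j - j). H = contract r F"
      by (intro double_annihilator[OF F_forms]) (auto simp: perp_def)
    then obtain r where r: "r \<in> forms UNIV 0" "H = contract r F" by auto
    have "H = contract (single 0 (lookup r 0)) F" using r(2) by (simp flip: forms_0[OF r(1)])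
    then have "H = smult (lookup r 0) F" unfolding contract_constant_term .
    then show "H \<in> kspan {F}" using mp.span_scale[OF mp.span_base[of F "{F}"]] by simp
  qed
  have "F \<in> perp UNIV I \<inter> forms UNIV j" using F_forms by (auto simp: perp_def Ann_def)
  moreover have "mp.subspace (perp UNIV I \<inter> forms UNIV j)"
    by (intro mp.subspace_inter subspace_forms)
       (auto simp: mp.subspace_def perp_def contract_add_right contract_smult_right)
  ultimately show "kspan {F} \<subseteq> perp UNIV I \<inter> forms UNIV j"
    by (intro mp.span_minimal) auto
qed

lemma perp_I_high:
  assumes "i > j"
  shows "perp UNIV I \<inter> forms UNIV i = {0}"
proof -
  have "H = 0" if H: "H \<in> perp UNIV I" "H \<in> forms UNIV i" for H
  proof (rule poly_mapping_eqI)
    fix m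
    show "lookup H m = lookup 0 m"
    proof (cases "mdeg m = i")
      case True
      have m: "single m (1::'k) \<in> forms UNIV i" using True by (intro forms_single) auto
      then have "single m 1 \<in> I" using contract_high_degree[OF F_forms m assms] by (simp add: Ann_def)
      then have "contract (single m 1) H = 0" using H(1) by (simp add: perp_def)
      then have "lookup (contract (single m 1) H) 0 = 0" by simp
      then show ?thesis by simp
    next
      case False
      then show ?thesis using forms_lookup[OF H(2)] by simp
    qed
  qed
  then show ?thesis by (auto simp: perp_def)
qed

lemma perp_I_orbit:
  assumes "i \<le> j"
  shows "perp UNIV I \<inter> forms UNIV i = act_orbit UNIV F \<inter> forms UNIV i"
proof
  show "perp UNIV I \<inter> forms UNIV i \<subseteq> act_orbit UNIV F \<inter> forms UNIV i"
  proof
    fix H :: "'k mpoly" assume H: "H \<in> perp UNIV I \<inter> forms UNIV i"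
    then have "\<exists>r\<in>forms UNIV (j - i). H = contract r F"
      using assms by (intro double_annihilator[OF F_forms]) (auto simp: perp_def)
    then show "H \<in> act_orbit UNIV F \<inter> forms UNIV i" using H by (auto simp: act_orbit_def)
  qed
  have "contract h (contract r F) = 0" if "h \<in> I" for h r
  proof -
    have "contract h (contract r F) = contract r (contract h F)"
      by (metis contract_mult mult.commute)
    then show ?thesis using that by (simp add: Ann_def)
  qed
  then show "act_orbit UNIV F \<inter> forms UNIV i \<subseteq> perp UNIV I \<inter> forms UNIV i"
    by (auto simp: act_orbit_def perp_def)
qed

lemma orbit_F:
  assumes "1 \<le> i" "i \<le> j - 1"
  shows "act_orbit UNIV F \<inter> forms UNIV i
    = kspan ((act_orbit R'vars G \<inter> forms R'vars i) \<union> {DPow vW i})" (is "?A = kspan ?B")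
proof
  have i: "i \<le> j" "1 \<le> j - i" "j - i \<le> j" "j - (j - i) = i" using assms j1 by auto
  show "?A \<subseteq> kspan ?B"
  proof
    fix H assume "H \<in> ?A"
    then obtain r where r: "r \<in> forms UNIV (j - i)" "H = contract r F"
      using orbit_forms[OF _ _ F_forms i(1), of H UNIV UNIV] by auto
    have "contract (restrict_vars R'vars r) G \<in> act_orbit R'vars G \<inter> forms R'vars i"
      using contract_forms[OF G restrict_vars_forms[OF r(1), of R'vars] i(3)] i(4)
      by (auto simp: act_orbit_def)
    moreover have "H = contract (restrict_vars R'vars r) G
        + smult (\<alpha> * lookup r (single vW (j - i))) (DPow vW i)"
      using contract_F[OF r(1) i(3)] r(2) i(4) by simp
    ultimately show "H \<in> kspan ?B"
      by (metis mp.span_add mp.span_scale mp.span_base UnI1 UnI2 singletonI)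
  qed
  \<comment> \<open>Closure under addition is read off from the inverse system, which equals the
    orbit in this degree.\<close>
  have "mp.subspace ?A"
    using perp_I_orbit[OF i(1), symmetric]
    by (simp only:, intro mp.subspace_inter subspace_forms)
       (auto simp: mp.subspace_def perp_def contract_add_right contract_smult_right)
  moreover have "?B \<subseteq> ?A"
  proof -
    have "H \<in> ?A" if H: "H \<in> act_orbit R'vars G \<inter> forms R'vars i" for H
    proof -
      obtain r where r: "r \<in> forms R'vars (j - i)" "H = contract r G"
        using orbit_forms[OF _ _ G i(1), of H R'vars R'vars] H by auto
      \<comment> \<open>As \<open>i < j\<close>, the multiplier \<open>r\<close> has positive degree
        in x, y, z and kills W^[j].\<close>
      have "contract r F = H"
        using contract_F[OF forms_mono[OF _ r(1), of UNIV] i(3)] r i(2)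
        by (simp add: lookup_single_vW restrict_vars_id forms_polyring)
      moreover have "H \<in> forms UNIV i" using H forms_mono by blast
      ultimately show ?thesis by (auto simp: act_orbit_def)
    qed
    moreover have "DPow vW i \<in> ?A"
    proof -
      \<comment> \<open>The power of w kills \<open>G\<close> and lowers \<alpha> W^[j] to \<alpha>
        W^[i]; the factor removes \<alpha>.\<close>
      let ?r = "smult (1 / \<alpha>) (DPow vW (j - i)) :: 'k mpoly"
      have "?r \<in> forms UNIV (j - i)" by (intro forms_smult DPow_forms) simp
      then have "contract ?r F = DPow vW i"
        using contract_F[of ?r "j - i"] i \<alpha>0
        by (simp add: restrict_vars_smult DPow_def restrict_vars_single)
      then have "DPow vW i \<in> act_orbit UNIV F" by (auto simp: act_orbit_def intro!: exI[of _ ?r])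
      then show ?thesis using DPow_forms[of vW UNIV i] by simp
    qed
    ultimately show ?thesis by blast
  qed
  ultimately show "kspan ?B \<subseteq> ?A" by (intro mp.span_minimal)
qed

end

section \<open>Minimality of the generators\<close>

lemma hcomp_mult_form:
  fixes a :: "'k::comm_ring_1 mpoly"
  assumes g: "g \<in> forms V j"
  shows "hcomp d (a * g) = (if j \<le> d then hcomp (d - j) a * g else 0)"
proof (induct a rule: mpoly_induct)
  case (single m c)
  have "hcomp (d - j) (single m c) = (if mdeg m = d - j then single m c else 0)"
    by (intro poly_mapping_eqI) (auto simp: lookup_single when_def)
  then show ?case by (auto simp: hcomp_single_mult hcomp_form[OF g])
qed (auto simp: hcomp_add distrib_right)

lemma mdeg_pos_split:
  assumes "mdeg m = Suc d"
  obtains v k where "v \<in> keys m" "m = single v 1 + k" "mdeg k = d"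
proof -
  have "m \<noteq> 0" using assms by auto
  then obtain v where v: "v \<in> keys m" by (metis all_not_in_conv keys_eq_empty)
  have m: "m = single v 1 + (m - single v 1)"
    using v by (intro poly_mapping_eqI) (auto simp: lookup_add lookup_minus lookup_single when_def in_keys_iff)
  then have "mdeg m = 1 + mdeg (m - single v 1)" by (metis mdeg_add mdeg_single)
  then have "mdeg (m - single v 1) = d" using assms by simp
  then show ?thesis using that v m by blast
qed

lemma Var_forms: "v \<in> V \<Longrightarrow> Var v \<in> forms V 1"
  unfolding Var_def by (intro forms_single) auto

context connected_sum
begin

context
  assumes J1: "\<And>h. h \<in> J \<Longrightarrow> h \<in> forms R'vars 1 \<Longrightarrow> h = 0"
begin

text \<open>As \<open>J\<close> has no linear form, the contractions of \<open>G\<close> by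
  \<open>u\<close> and \<open>v\<close> are independent. A functional that is 1 on the first and 0
  on the second is represented by a form of degree \<open>j - 1\<close>, then scaled by \<alpha> to
  match \<open>g\<close>.\<close>

lemma exists_multiplier:
  assumes "v \<in> R'vars" "u \<in> R'vars" "u \<noteq> v"
  obtains p where "p \<in> forms R'vars (j - 1)" "contract (p * Var u) G = single 0 \<alpha>" "contract (p * Var v) G = 0"
proof -
  define A where "A = contract (Var u) G"
  define B where "B = contract (Var v) G"
  have AB: "A \<in> forms R'vars (j - 1)" "B \<in> forms R'vars (j - 1)"
    unfolding A_def B_def using contract_forms[OF G Var_forms] assms j1 by auto
  have "A \<notin> mp.span {B}"
  proof
    assume "A \<in> mp.span {B}"
    then obtain c where "A = smult c B" by (auto simp: mp.span_singleton)
    then have "contract (Var u - smult c (Var v)) G = 0"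
      by (simp add: A_def B_def contract_diff_left contract_smult_left)
    moreover have f: "Var u - smult c (Var v) \<in> forms R'vars 1"
      using assms by (intro forms_diff forms_smult Var_forms)
    ultimately have "Var u - smult c (Var v) = 0"
      by (intro J1) (auto simp: Ann_def forms_polyring)
    then have "lookup (Var u - smult c (Var v)) (single u 1) = 0" by simp
    moreover have "single v 1 \<noteq> single u (1::nat)"
      using assms(3) by (metis keys_single one_neq_zero singleton_inject)
    ultimately show False by (simp add: Var_def lookup_minus lookup_single_not_eq)
  qed
  then obtain f :: "'k mpoly \<Rightarrow> 'k" where f: "\<And>p q. f (p + q) = f p + f q"
    "\<And>c p. f (smult c p) = c * f p" "\<And>q. q \<in> mp.span {B} \<Longrightarrow> f q = 0" "f A = 1"
    using exists_functional[of "mp.span {B}" A] by (metis mp.subspace_span)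
  obtain p where p: "p \<in> forms R'vars (j - 1)"
    "\<And>q. q \<in> forms R'vars (j - 1) \<Longrightarrow> lookup (contract q p) 0 = f q"
    using functional_form[of f R'vars "j - 1", OF f(1,2)] by blast
  have pq: "contract p q = single 0 (f q)" if "q \<in> forms R'vars (j - 1)" for q
    using contract_constant[OF that p(1)] p(2)[OF that] by (simp add: lookup_contract_commute[of q])
  show ?thesis
  proof
    show "smult \<alpha> p \<in> forms R'vars (j - 1)" using p(1) by (rule forms_smult)
    show "contract (smult \<alpha> p * Var u) G = single 0 \<alpha>"
      using pq[OF AB(1)] f(4) smult_conv_mult[of \<alpha> 1]
      by (simp add: contract_mult contract_smult_left flip: A_def)
    show "contract (smult \<alpha> p * Var v) G = 0"
      using pq[OF AB(2)] f(3)[OF mp.span_base[of B "{B}"]]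
      by (simp add: contract_mult contract_smult_left flip: B_def)
  qed
qed

text \<open>As no linear form kills \<open>G\<close>, the ideal \<open>J\<close> needs no generators in degrees above \<open>j\<close>.\<close>

lemma high_forms_generated:
  assumes L: "is_ideal R'vars L" and JL: "\<And>h. h \<in> J \<Longrightarrow> h \<in> forms R'vars j \<Longrightarrow> h \<in> L"
  shows "d > j \<Longrightarrow> forms R'vars d \<subseteq> L"
proof -
  obtain g where g: "g \<in> forms R'vars j" "contract g G = single 0 \<alpha>" by (rule obtain_g)
  have VR: "(Var v :: 'k mpoly) \<in> polyring R'vars" if "v \<in> R'vars" for v
    using Var_forms[OF that] by (rule forms_polyring)
  \<comment> \<open>With \<open>p\<close> from \<open>exists_multiplier\<close>, both g - p u and p
    v lie in \<open>J\<close> in degree \<open>j\<close>, hence in \<open>L\<close>, and v g = v (g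
    - p u) + u (p v).\<close>
  have vg: "Var v * g \<in> L" if v: "v \<in> R'vars" for v
  proof -
    obtain u where u: "u \<in> R'vars" "u \<noteq> v" by (cases "v = vX") (auto simp: R'vars_def)
    obtain p where p: "p \<in> forms R'vars (j - 1)" "contract (p * Var u) G = single 0 \<alpha>"
      "contract (p * Var v) G = 0"
      using exists_multiplier[OF v u] .
    have pf: "p * Var x \<in> forms R'vars j" if "x \<in> R'vars" for x
      using forms_mult[OF p(1) Var_forms[OF that]] j1 by simp
    have 1: "g - p * Var u \<in> L"
      using g p(2) pf[OF u(1)] by (intro JL) (auto simp: Ann_def contract_diff_left forms_polyring forms_diff polyring_diff)
    have 2: "p * Var v \<in> L"
      using p(3) pf[OF v] by (intro JL) (auto simp: Ann_def forms_polyring)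
    have "Var v * g = Var v * (g - p * Var u) + Var u * (p * Var v)"
      by (simp add: algebra_simps)
    also have "\<dots> \<in> L"
      by (rule is_idealD(3)[OF L is_idealD(4)[OF L 1 VR[OF v]] is_idealD(4)[OF L 2 VR[OF u(1)]]])
    finally show ?thesis .
  qed
  have mono: "single m c \<in> L" if "keys m \<subseteq> R'vars" "mdeg m = d" "d > j" for m c d
    using that
  proof (induct d arbitrary: m)
    case (Suc d)
    obtain v k where vk: "v \<in> keys m" "m = single v 1 + k" "mdeg k = d"
      using mdeg_pos_split[OF Suc.prems(2)] .
    have k: "keys k \<subseteq> R'vars" using Suc.prems(1) vk(2) by (auto simp: keys_add_nat)
    have v: "v \<in> R'vars" using vk(1) Suc.prems(1) by blast
    have eq: "single m c = Var v * single k c" by (simp add: Var_def mult_single vk(2))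
    show ?case
    proof (cases "d = j")
      case True
      have kj: "single k c \<in> forms R'vars j" using k vk(3) True by (intro forms_single) auto
      \<comment> \<open>Modulo \<open>J\<close> every form of degree \<open>j\<close> is a multiple
        of \<open>g\<close>; \<open>e\<close> is that factor, the ratio of the two
        constants.\<close>
      define e where "e = lookup (contract (single k c) G) 0 / \<alpha>"
      have "contract (single k c) G = single 0 (e * \<alpha>)"
        using contract_constant[OF G kj] \<alpha>0 by (simp add: e_def)
      then have "contract (single k c - smult e g) G = 0"
        using g(2) by (simp add: contract_diff_left contract_smult_left smult_single)
      then have kL: "single k c - smult e g \<in> L"
        using kj g(1) by (intro JL) (auto simp: Ann_def intro!: forms_diff forms_smult polyring_diff polyring_smult forms_polyring)
      have "Var v * (single k c - smult e g) + smult e (Var v * g) \<in> L"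
        by (rule is_idealD(3)[OF L is_idealD(4)[OF L kL VR[OF v]] is_ideal_smult[OF L vg[OF v]]])
      then show ?thesis by (simp add: eq mult_smult_right algebra_simps)
    next
      case False
      then have "single k c \<in> L" using Suc k vk(3) by auto
      then show ?thesis unfolding eq using VR[OF v] by (rule is_idealD(4)[OF L])
    qed
  qed simp
  show "forms R'vars d \<subseteq> L" if "d > j"
  proof
    fix p :: "'k mpoly" assume "p \<in> forms R'vars d"
    then show "p \<in> L"
      using that by (subst mpoly_sum_single) (intro is_ideal_sum[OF L] mono, auto simp: forms_def polyring_def)
  qed
qed

context
  fixes g
  assumes g: "g \<in> forms R'vars j" and gG: "contract g G = single 0 \<alpha>"
begin

text \<open>If \<open>b\<close> were redundant, setting w = 0 would give b = a g modulo
  \<open>L\<close>, the ideal of the remaining members of \<open>B\<close>. Comparing components in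
  the degree \<open>d\<close> of \<open>b\<close> leads to \<open>b \<in> L\<close> in each of the
  cases \<open>d < j\<close>, \<open>d = j\<close>, \<open>d > j\<close>.\<close>

lemma J_generator_irredundant:
  assumes B: "minimal_gens R'vars J B" and b: "b \<in> B"
  shows "b \<notin> ideal_gen UNIV ((B - {b}) \<union> (wxyz \<union> {DPow vW j - g}))"
proof
  define L where "L = ideal_gen R'vars (B - {b})"
  have hom: "\<And>x. x \<in> B \<Longrightarrow> \<exists>i. x \<in> forms R'vars i" and genB: "ideal_gen R'vars B = J"
    and min: "b \<notin> L"
    using B b by (auto simp: minimal_gens_def L_def)
  have grL: "graded_ideal R'vars L" unfolding L_def by (rule graded_ideal_gen) (use hom in blast)
  then have L: "is_ideal R'vars L" by (simp add: graded_ideal_def)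
  have BL: "B - {b} \<subseteq> L" unfolding L_def by (rule ideal_gen_superset)
  have BJ: "B \<subseteq> J" using genB ideal_gen_superset by blast
  have LJ: "L \<subseteq> J" unfolding L_def using BJ by (intro ideal_gen_least[OF id_J]) auto
  obtain d where d: "b \<in> forms R'vars d" using hom[OF b] by blast
  \<comment> \<open>The polynomials whose restriction to w = 0 lies in \<open>L\<close> + (g). It
    contains all other generators, since wx, wy, wz restrict to 0 and w^j - g restricts to
    -g.\<close>
  define M where "M = {p. \<exists>a\<in>polyring R'vars. restrict_vars R'vars p - a * g \<in> L}"
  have "is_ideal UNIV M"
    unfolding is_ideal_def
  proof (intro conjI ballI)
    show "M \<subseteq> polyring UNIV" by simp
    show "0 \<in> M" unfolding M_def using is_idealD(2)[OF L] by (auto intro!: bexI[of _ 0])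
    fix p assume "p \<in> M"
    then obtain a where a: "a \<in> polyring R'vars" "restrict_vars R'vars p - a * g \<in> L"
      by (auto simp: M_def)
    { fix q assume "q \<in> M"
      then obtain a' where a': "a' \<in> polyring R'vars" "restrict_vars R'vars q - a' * g \<in> L"
        by (auto simp: M_def)
      have "restrict_vars R'vars (p + q) - (a + a') * g
          = (restrict_vars R'vars p - a * g) + (restrict_vars R'vars q - a' * g)"
        by (simp add: restrict_vars_add algebra_simps)
      also have "\<dots> \<in> L" using a(2) a'(2) by (rule is_idealD(3)[OF L])
      finally show "p + q \<in> M" unfolding M_def using polyring_add[OF a(1) a'(1)] by blast }
    { fix r :: "'k mpoly"
      have "restrict_vars R'vars (r * p) - (restrict_vars R'vars r * a) * g
          = restrict_vars R'vars r * (restrict_vars R'vars p - a * g)"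
        by (simp add: restrict_vars_mult algebra_simps)
      also have "\<dots> \<in> L" using a(2) by (rule is_idealD(4)[OF L]) simp
      finally show "r * p \<in> M" unfolding M_def using polyring_mult[OF restrict_vars_polyring a(1)] by blast }
  qed
  moreover have "(B - {b}) \<union> (wxyz \<union> {DPow vW j - g}) \<subseteq> M"
  proof -
    have "x \<in> M" if "x \<in> B - {b}" for x
    proof -
      have "x \<in> L" using that BL by blast
      moreover then have "restrict_vars R'vars x = x"
        using is_idealD(1)[OF L] by (intro restrict_vars_id) blast
      ultimately show ?thesis unfolding M_def by (auto intro!: bexI[of _ 0])
    qed
    moreover have "x \<in> M" if "x \<in> wxyz" for x
      using restrict_wxyz[OF that] is_idealD(2)[OF L] by (auto simp: M_def intro!: bexI[of _ 0])
    moreover have "DPow vW j - g \<in> M"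
    proof -
      have "restrict_vars R'vars (DPow vW j - g) - (- 1) * g = 0"
        using j1 g by (simp add: restrict_vars_diff restrict_vars_id forms_polyring DPow_def restrict_vars_single)
      moreover have "(- 1 :: 'k mpoly) \<in> polyring R'vars"
        using polyring_diff[OF polyring_zero[of R'vars] polyring_single[of 0 R'vars "1::'k"]] by simp
      ultimately show ?thesis unfolding M_def using is_idealD(2)[OF L] by (metis (mono_tags, lifting) mem_Collect_eq)
    qed
    ultimately show ?thesis by blast
  qed
  ultimately have genM: "ideal_gen UNIV ((B - {b}) \<union> (wxyz \<union> {DPow vW j - g})) \<subseteq> M"
    by (rule ideal_gen_least)
  assume "b \<in> ideal_gen UNIV ((B - {b}) \<union> (wxyz \<union> {DPow vW j - g}))"
  then have "b \<in> M" using genM by blast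
  then obtain a where "b - a * g \<in> L"
    using d by (auto simp: M_def restrict_vars_id forms_polyring)
  then have "hcomp d (b - a * g) \<in> L" using grL by (simp add: graded_ideal_def)
  then have bL: "b - hcomp d (a * g) \<in> L" by (simp add: hcomp_diff hcomp_form[OF d])
  consider "d < j" | "d = j" | "d > j" by linarith
  then have "b \<in> L"
  proof cases
    case 1
    then show ?thesis using bL by (simp add: hcomp_mult_form[OF g])
  next
    case 2
    define e where "e = lookup (hcomp 0 a) 0"
    have "hcomp 0 a = single 0 e"
      unfolding e_def by (rule forms_0[of _ UNIV]) (simp add: forms_hcomp)
    then have be: "b - smult e g \<in> L" using bL 2 by (simp add: hcomp_mult_form[OF g] smult_conv_mult)
    then have "b - smult e g \<in> J" "b \<in> J" using LJ BJ b by auto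
    \<comment> \<open>A nonzero \<open>e\<close> would put \<open>g\<close> into \<open>J\<close>,
      although \<open>g\<close> contracts \<open>G\<close> to a nonzero constant.\<close>
    then have "b - (b - smult e g) \<in> J" by (intro is_ideal_diff[OF id_J, of b "b - smult e g"])
    also have "b - (b - smult e g) = smult e g" by simp
    finally have "smult e g \<in> J" .
    then have "single 0 (e * \<alpha>) = (0 :: 'k mpoly)" using gG by (simp add: Ann_def contract_smult_left smult_single)
    then have "lookup (single (0 :: var \<Rightarrow>\<^sub>0 nat) (e * \<alpha>)) 0 = 0" by (simp only: lookup_zero)
    then have "e = 0" using \<alpha>0 by simp
    then show ?thesis using be by simp
  next
    case 3
    \<comment> \<open>Below degree \<open>d\<close> the generator \<open>b\<close> has no effect, so
      components of elements of \<open>J\<close> there already lie in \<open>L\<close>. In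
      particular \<open>L\<close> contains the degree \<open>j\<close> part of \<open>J\<close>, and
      \<open>high_forms_generated\<close> applies.\<close>
    define N where "N = {p \<in> polyring R'vars. \<forall>i<d. hcomp i p \<in> L}"
    have "is_ideal R'vars N"
      unfolding N_def using is_idealD(2)[OF L]
      by (intro is_idealI)
        (auto simp: polyring_add hcomp_add hcomp_single_mult is_idealD[OF L] polyring_single polyring_mult)
    moreover have "B \<subseteq> N"
    proof
      fix x assume x: "x \<in> B"
      show "x \<in> N"
      proof (cases "x = b")
        case True
        then show ?thesis using d is_idealD(2)[OF L] by (auto simp: N_def forms_polyring hcomp_form)
      next
        case False
        then show ?thesis using x BL grL is_idealD(1)[OF L] by (auto simp: N_def graded_ideal_def)
      qed
    qed
    ultimately have "J \<subseteq> N" unfolding genB[symmetric] by (rule ideal_gen_least)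
    have "h \<in> L" if "h \<in> J" "h \<in> forms R'vars j" for h
    proof -
      have "hcomp j h \<in> L" using \<open>J \<subseteq> N\<close> that(1) 3 unfolding N_def by blast
      then show ?thesis using hcomp_form[OF that(2), of j] by simp
    qed
    then show ?thesis using high_forms_generated[OF L _ 3] d by blast
  qed
  then show False using min by simp
qed

context
  assumes J2: "\<And>h. h \<in> J \<Longrightarrow> h \<in> forms R'vars 2 \<Longrightarrow> h = 0" and j3: "j \<ge> 3"
begin

text \<open>Read as a divided power form, \<open>c\<close> is its own witness: it contracts itself
  to a nonzero constant, whereas the other generators annihilate it, being a different monomial of
  degree 2 or zero or of degree at least 3.\<close>

lemma wxyz_irredundant:
  assumes hom: "\<And>x. x \<in> B \<Longrightarrow> \<exists>i. x \<in> forms R'vars i" and BJ: "B \<subseteq> J" and c: "c \<in> wxyz"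
  shows "c \<notin> ideal_gen UNIV (B \<union> ((wxyz - {c}) \<union> {DPow vW j - g}))"
proof
  obtain v where v: "v \<in> R'vars" "c = single (single vW 1 + single v 1) 1"
    using c unfolding wxyz_iff by blast
  have c2: "c \<in> forms UNIV 2" using c by (rule wxyz_forms)
  have "ideal_gen UNIV (B \<union> ((wxyz - {c}) \<union> {DPow vW j - g})) \<subseteq> Ann UNIV c"
  proof (rule ideal_gen_subset_Ann)
    fix b assume "b \<in> B \<union> ((wxyz - {c}) \<union> {DPow vW j - g})"
    then consider "b \<in> B" | "b \<in> wxyz" "b \<noteq> c" | "b = DPow vW j - g" by blast
    then show "contract b c = 0"
    proof cases
      case 1
      then obtain i where i: "b \<in> forms R'vars i" using hom by blast
      have "b \<in> J" using 1 BJ by blast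
      have "b \<in> I" using \<open>b \<in> J\<close> I_inter_R' by blast
      have "b = 0" if i2: "i \<le> 2"
      proof -
        consider "i = 0" | "i = 1" | "i = 2" using i2 by linarith
        then show ?thesis
          using J1[OF \<open>b \<in> J\<close>] J2[OF \<open>b \<in> J\<close>] I_0[OF \<open>b \<in> I\<close>] i forms_mono[of R'vars UNIV b 0]
          by cases auto
      qed
      then show ?thesis using contract_high_degree[OF c2 i] by (cases "i \<le> 2") auto
    next
      case 2
      then obtain u where u: "u \<in> R'vars" "b = single (single vW 1 + single u 1) 1"
        unfolding wxyz_iff by blast
      then have uv: "u \<noteq> v" using 2(2) v by auto
      have ne: "u \<noteq> vW" using u(1) by auto
      have "single vW 1 + single u 1 + k \<noteq> single vW 1 + single v 1" for k :: "var \<Rightarrow>\<^sub>0 nat"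
      proof
        assume "single vW 1 + single u 1 + k = single vW 1 + single v 1"
        then have "lookup (single vW 1 + single u 1 + k) u = lookup (single vW 1 + single v 1) u" by simp
        then show False using uv ne by (simp add: lookup_add lookup_single when_def)
      qed
      then show ?thesis
        by (intro poly_mapping_eqI) (simp add: u(2) v(2) lookup_single when_def eq_commute)
    next
      case 3
      have "b \<in> forms UNIV j"
        unfolding 3 using g by (intro forms_diff DPow_forms forms_mono[of R'vars UNIV]) auto
      then show ?thesis using contract_high_degree[OF c2 _, of b UNIV j] j3 by simp
    qed
  qed simp
  moreover have "contract c c \<noteq> 0"
  proof
    assume "contract c c = 0"
    then have "lookup (contract c c) 0 = 0" by simp
    then show False by (simp add: v(2))
  qed
  moreover assume "c \<in> ideal_gen UNIV (B \<union> ((wxyz - {c}) \<union> {DPow vW j - g}))"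
  ultimately show False by (auto simp: Ann_def)
qed

text \<open>W^[j] is killed by wx, wy, wz and by forms of positive degree in x, y, z, but w^j - g
  contracts it to 1. Constants in \<open>J\<close> are zero.\<close>

lemma power_irredundant:
  assumes hom: "\<And>x. x \<in> B \<Longrightarrow> \<exists>i. x \<in> forms R'vars i" and BJ: "B \<subseteq> J"
  shows "DPow vW j - g \<notin> ideal_gen UNIV (B \<union> wxyz)"
proof
  have cR: "contract h (DPow vW j) = 0" if "h \<in> forms R'vars i" "i \<noteq> 0" for h :: "'k mpoly" and i
  proof (cases "i \<le> j")
    case True
    then show ?thesis using contract_DPow[OF that(1) True] that by (simp add: lookup_single_vW forms_polyring)
  next
    case False
    then show ?thesis using contract_high_degree[OF DPow_forms[of vW UNIV j] that(1)] by simp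
  qed
  have "ideal_gen UNIV (B \<union> wxyz) \<subseteq> Ann UNIV (DPow vW j)"
  proof (rule ideal_gen_subset_Ann)
    fix b :: "'k mpoly" assume "b \<in> B \<union> wxyz"
    then show "contract b (DPow vW j) = 0"
    proof
      assume "b \<in> B"
      then obtain i where i: "b \<in> forms R'vars i" using hom by blast
      show ?thesis
      proof (cases "i = 0")
        case True
        have "b \<in> I" using \<open>b \<in> B\<close> BJ I_inter_R' by blast
        then have "b = 0" using I_0 i True forms_mono[of R'vars UNIV b 0] by blast
        then show ?thesis by simp
      qed (rule cR[OF i])
    qed (rule contract_wxyz(2))
  qed simp
  moreover have "contract (DPow vW j - g) (DPow vW j) = (1 :: 'k mpoly)"
    using cR[OF g] j1 contract_DPow[OF DPow_forms[of vW UNIV j], of j vW]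
    by (simp add: contract_diff_left lookup_DPow) (simp add: DPow_def[of _ 0])
  moreover assume "DPow vW j - g \<in> ideal_gen UNIV (B \<union> wxyz)"
  ultimately show False by (auto simp: Ann_def)
qed

lemma minimal_gens_I:
  assumes B: "minimal_gens R'vars J B"
  shows "minimal_gens UNIV I (B \<union> (wxyz \<union> {DPow vW j - g}))"
  unfolding minimal_gens_def
proof (intro conjI ballI)
  have hom: "\<And>x. x \<in> B \<Longrightarrow> \<exists>i. x \<in> forms R'vars i" and genB: "ideal_gen R'vars B = J"
    using B by (auto simp: minimal_gens_def)
  have BJ: "B \<subseteq> J" using genB ideal_gen_superset by blast
  let ?B = "B \<union> (wxyz \<union> {DPow vW j - g})"
  have id: "is_ideal UNIV (ideal_gen UNIV ?B)" by (rule is_ideal_ideal_gen) simp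
  have sup: "?B \<subseteq> ideal_gen UNIV ?B" by (rule ideal_gen_superset)
  show "ideal_gen UNIV ?B = I"
  proof
    \<comment> \<open>\<open>B\<close> generates \<open>J\<close> over R' only, so the ideal over R
      is first cut down to an ideal of R' containing \<open>B\<close>.\<close>
    have "is_ideal R'vars (ideal_gen UNIV ?B \<inter> polyring R'vars)"
      using id by (auto simp: is_ideal_def polyring_add polyring_mult)
    moreover have "B \<subseteq> ideal_gen UNIV ?B \<inter> polyring R'vars"
      using sup hom by (auto simp: forms_def)
    ultimately have "J \<subseteq> ideal_gen UNIV ?B \<inter> polyring R'vars"
      unfolding genB[symmetric] by (rule ideal_gen_least)
    then show "I \<subseteq> ideal_gen UNIV ?B"
      unfolding I_generators[OF g gG] using sup by (intro ideal_gen_least[OF id]) auto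
    show "ideal_gen UNIV ?B \<subseteq> I"
      unfolding I_generators[OF g gG] using BJ ideal_gen_superset[of "J \<union> (wxyz \<union> {DPow vW j - g})" UNIV]
      by (intro ideal_gen_least is_ideal_ideal_gen) auto
  qed
  fix b assume b: "b \<in> ?B"
  show "\<exists>i. b \<in> forms UNIV i"
  proof -
    have "DPow vW j - g \<in> forms UNIV j"
      using g by (intro forms_diff DPow_forms forms_mono[of R'vars UNIV]) auto
    with b hom wxyz_forms[of b] show ?thesis using forms_mono[of R'vars UNIV b] by blast
  qed
  \<comment> \<open>Inclusions suffice when \<open>b\<close> is removed, so possible overlaps
    between the three kinds of generators do not matter.\<close>
  have mono: "X \<subseteq> Y \<Longrightarrow> ideal_gen UNIV X \<subseteq> ideal_gen UNIV Y" for X Y :: "'k mpoly set"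
    by (auto simp: ideal_gen_def)
  consider "b \<in> B" | "b \<in> wxyz" | "b = DPow vW j - g" using b by blast
  then show "b \<notin> ideal_gen UNIV (?B - {b})"
  proof cases
    case 1
    then show ?thesis
      using J_generator_irredundant[OF B 1] mono[of "?B - {b}" "(B - {b}) \<union> (wxyz \<union> {DPow vW j - g})"] by blast
  next
    case 2
    then show ?thesis
      using wxyz_irredundant[OF hom BJ 2] mono[of "?B - {b}" "B \<union> ((wxyz - {b}) \<union> {DPow vW j - g})"] by blast
  next
    case 3
    then show ?thesis
      using power_irredundant[OF hom BJ] mono[of "?B - {b}" "B \<union> wxyz"] by blast
  qed
qed

end
end
end
end

subsection \<open>Linear changes of coordinates\<close>

lemma kdim_image_injective:
  fixes f :: "'k::field mpoly \<Rightarrow> 'k mpoly"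
  assumes f: "Vector_Spaces.linear smult smult f" and inj: "inj f"
  shows "kdim (f ` X) = kdim X"
proof -
  interpret pr: vector_space_pair "smult :: 'k \<Rightarrow> 'k mpoly \<Rightarrow> 'k mpoly" smult ..
  obtain B where B: "B \<subseteq> X" "mp.independent B" "X \<subseteq> mp.span B" "card B = kdim X"
    using mp.basis_exists by blast
  have "mp.independent (f ` B)"
    using pr.linear_independent_injective_image[OF f B(2)] inj by (meson inj_on_subset subset_UNIV)
  moreover have "f ` X \<subseteq> mp.span (f ` B)"
    using B(3) pr.linear_span_image[OF f, of B] by auto
  ultimately have "card (f ` B) = kdim (f ` X)"
    using B(1) by (intro mp.basis_card_eq_dim) auto
  moreover have "card (f ` B) = card B" using inj by (intro card_image) (meson inj_on_subset subset_UNIV)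
  ultimately show ?thesis using B(4) by simp
qed

text \<open>The product runs over all variables instead of the support as in \<open>subst\<close>,
  so the index set is the same for every monomial and exponents add factorwise.\<close>

definition eval_monomial :: "(var \<Rightarrow> 'k::comm_ring_1 mpoly) \<Rightarrow> (var \<Rightarrow>\<^sub>0 nat) \<Rightarrow> 'k mpoly" where
  "eval_monomial \<sigma> m = (\<Prod>v\<in>UNIV. \<sigma> v ^ lookup m v)"

lemma eval_monomial_add: "eval_monomial \<sigma> (m + n) = eval_monomial \<sigma> m * eval_monomial \<sigma> n"
  by (simp add: eval_monomial_def lookup_add power_add prod.distrib)

lemma subst_eval: "subst \<sigma> p = (\<Sum>m\<in>keys p. smult (lookup p m) (eval_monomial \<sigma> m))"
proof -
  have "(\<Prod>v\<in>keys m. \<sigma> v ^ lookup m v) = eval_monomial \<sigma> m" for m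
    unfolding eval_monomial_def by (rule prod.mono_neutral_left) (auto simp: in_keys_iff)
  then show ?thesis by (simp add: subst_def)
qed

lemma subst_superset:
  assumes "finite A" "keys p \<subseteq> A"
  shows "subst \<sigma> p = (\<Sum>m\<in>A. smult (lookup p m) (eval_monomial \<sigma> m))"
  unfolding subst_eval using assms
  by (intro sum.mono_neutral_left) (auto simp: in_keys_iff smult_conv_mult)

lemma subst_zero [simp]: "subst \<sigma> 0 = 0"
  by (simp add: subst_eval)

lemma subst_single: "subst \<sigma> (single m c) = smult c (eval_monomial \<sigma> m)"
  by (subst subst_superset[of "{m}"]) auto

lemma subst_add: "subst \<sigma> (p + q) = subst \<sigma> p + subst \<sigma> q"
proof -
  have "finite (keys p \<union> keys q)" "keys (p + q) \<subseteq> keys p \<union> keys q"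
    by (auto simp: Poly_Mapping.keys_add)
  then show ?thesis
    by (simp add: subst_superset[of "keys p \<union> keys q"] lookup_add smult_conv_mult single_add
        distrib_right sum.distrib)
qed

lemma subst_mult:
  fixes p :: "'a::comm_ring_1 mpoly"
  shows "subst \<sigma> (p * q) = subst \<sigma> p * subst \<sigma> q"
proof (induct p rule: mpoly_induct)
  case (single m a)
  show ?case
  proof (induct q rule: mpoly_induct)
    case (single n b)
    have "subst \<sigma> (single m a * single n b)
        = single 0 (a * b) * (eval_monomial \<sigma> m * eval_monomial \<sigma> n)"
      by (simp add: mult_single subst_single eval_monomial_add smult_conv_mult)
    also have "single 0 (a * b) = single 0 a * (single 0 b :: 'a mpoly)"
      by (simp add: mult_single)
    also have "single 0 a * single 0 b * (eval_monomial \<sigma> m * eval_monomial \<sigma> n)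
        = (single 0 a * eval_monomial \<sigma> m) * (single 0 b * eval_monomial \<sigma> n)"
      by (simp only: mult_ac)
    finally show ?case by (simp only: subst_single smult_conv_mult)
  qed (auto simp: distrib_left subst_add)
qed (auto simp: distrib_right subst_add)

lemma subst_constant: "subst \<sigma> (single 0 c) = single 0 c"
  by (simp add: subst_single eval_monomial_def smult_conv_mult)

lemma subst_smult: "subst \<sigma> (smult c p) = smult c (subst \<sigma> p)"
  by (simp add: smult_conv_mult subst_mult subst_constant)

lemma subst_one: "subst \<sigma> 1 = 1"
  using subst_constant[of \<sigma> 1] by simp

lemma subst_power: "subst \<sigma> (p ^ n) = subst \<sigma> p ^ n"
  by (induct n) (simp_all add: subst_mult subst_one)

lemma subst_prod: "subst \<sigma> (\<Prod>a\<in>A. f a) = (\<Prod>a\<in>A. subst \<sigma> (f a))"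
  by (induct A rule: infinite_finite_induct) (simp_all add: subst_mult subst_one)

lemma subst_diff: "subst \<sigma> (p - q) = subst \<sigma> p - subst \<sigma> q"
  using subst_add[of \<sigma> "p - q" q] by (simp add: algebra_simps)

lemma Var_power: "Var v ^ n = single (single v n) 1"
  by (induct n) (simp_all add: Var_def mult_single flip: single_add)

lemma eval_monomial_Var: "eval_monomial Var m = single m 1"
proof -
  have "eval_monomial Var m = single (single vW (lookup m vW) + (single vX (lookup m vX)
      + (single vY (lookup m vY) + single vZ (lookup m vZ)))) 1"
    by (simp add: eval_monomial_def UNIV_var Var_power mult_single)
  also have "single vW (lookup m vW) + (single vX (lookup m vX)
      + (single vY (lookup m vY) + single vZ (lookup m vZ))) = m"
  proof (rule poly_mapping_eqI)
    fix v show "lookup (single vW (lookup m vW) + (single vX (lookup m vX)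
      + (single vY (lookup m vY) + single vZ (lookup m vZ)))) v = lookup m v"
      by (cases v) (auto simp: lookup_add lookup_single)
  qed
  finally show ?thesis .
qed

lemma subst_Var_id: "subst Var p = p"
  unfolding subst_eval eval_monomial_Var by (simp add: smult_single flip: mpoly_sum_single)

lemma subst_Var: "subst \<sigma> (Var v) = \<sigma> v"
proof -
  have "(\<Prod>x\<in>UNIV. \<sigma> x ^ lookup (single v (1::nat)) x) = (\<Prod>x\<in>{v}. \<sigma> x ^ lookup (single v (1::nat)) x)"
    by (rule prod.mono_neutral_right) (auto simp: lookup_single when_def)
  then show ?thesis
    by (simp add: Var_def subst_single eval_monomial_def smult_conv_mult)
qed

lemma subst_subst: "subst \<sigma> (subst \<tau> p) = subst (\<lambda>v. subst \<sigma> (\<tau> v)) p"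
proof (induct p rule: mpoly_induct)
  case (single m c)
  show ?case by (simp add: subst_single subst_smult eval_monomial_def subst_prod subst_power)
qed (simp_all add: subst_add)

lemma forms_power: "p \<in> forms V a \<Longrightarrow> p ^ n \<in> forms V (n * a)" for p :: "'k::comm_ring_1 mpoly"
proof (induct n)
  case 0
  show ?case using forms_single[of 0 V 0 "1 :: 'k"] by simp
next
  case (Suc n)
  then show ?case using forms_mult[of p V a "p ^ n" "n * a"] by simp
qed

lemma eval_monomial_forms:
  assumes "\<And>v. \<sigma> v \<in> forms UNIV 1"
  shows "eval_monomial \<sigma> m \<in> forms UNIV (mdeg m)"
proof -
  have P: "\<sigma> v ^ lookup m v \<in> forms UNIV (lookup m v)" for v
    using forms_power[OF assms, of v "lookup m v"] by simp
  have "eval_monomial \<sigma> m = \<sigma> vW ^ lookup m vW * (\<sigma> vX ^ lookup m vX * (\<sigma> vY ^ lookup m vY * \<sigma> vZ ^ lookup m vZ))"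
    by (simp add: eval_monomial_def UNIV_var)
  also have "\<dots> \<in> forms UNIV (lookup m vW + (lookup m vX + (lookup m vY + lookup m vZ)))"
    by (intro forms_mult P)
  finally show ?thesis by (simp add: mdeg_eq add.assoc)
qed

lemma hcomp_subst:
  assumes "\<And>v. \<sigma> v \<in> forms UNIV 1"
  shows "hcomp i (subst \<sigma> p) = subst \<sigma> (hcomp i p)"
proof (induct p rule: mpoly_induct)
  case (single m c)
  have "hcomp i (single m c) = (if mdeg m = i then single m c else 0)"
    by (intro poly_mapping_eqI) (auto simp: lookup_single when_def)
  then show ?case
    by (simp add: subst_single hcomp_smult hcomp_form[OF eval_monomial_forms[OF assms]])
      (simp add: smult_conv_mult)
qed (simp_all add: subst_add hcomp_add)

lemma subst_forms:
  assumes "\<And>v. \<sigma> v \<in> forms UNIV 1" "p \<in> forms UNIV i"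
  shows "subst \<sigma> p \<in> forms UNIV i"
proof -
  have "subst \<sigma> p = hcomp i (subst \<sigma> p)"
    using hcomp_form[OF assms(2), of i] by (simp add: hcomp_subst[OF assms(1)])
  also have "\<dots> \<in> forms UNIV i" by (rule forms_hcomp) simp
  finally show ?thesis .
qed

lemma mdeg_1: "mdeg m = 1 \<Longrightarrow> \<exists>v. m = single v 1"
proof -
  assume "mdeg m = 1"
  then obtain v k where "m = single v 1 + k" "mdeg k = 0" using mdeg_pos_split[of m 0] by (metis One_nat_def)
  then show ?thesis by (auto simp: mdeg_eq_0_iff)
qed

text \<open>\<open>socle\<close> tests variables only, but a linear change of coordinates sends
  variables to linear forms; linearity covers these.\<close>

lemma socle_linear_form:
  assumes "is_ideal UNIV I" "p \<in> socle UNIV I" "l \<in> forms UNIV 1"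
  shows "l * p \<in> I"
proof (induct l rule: mpoly_induct)
  case zero
  show ?case using is_idealD(2)[OF assms(1)] by simp
next
  case (single m c)
  then obtain v where "m = single v 1" using assms(3) mdeg_1 by (auto simp: forms_def)
  then have "single m c * p = smult c (Var v * p)"
    by (simp add: Var_def smult_conv_mult mult_single flip: mult.assoc)
  then show ?case using assms(1,2) by (simp add: socle_def is_ideal_smult)
next
  case (add q r)
  then show ?case using is_idealD(3)[OF assms(1)] by (simp add: distrib_right)
qed

lemma linear_change_graded_AG:
  fixes I :: "'k::field mpoly set"
  assumes \<sigma>: "linear_change \<sigma>" and AG: "graded_AG UNIV I j"
  shows "graded_AG UNIV (subst \<sigma> ` I) j"
    and "hilb UNIV (subst \<sigma> ` I) i = hilb UNIV I i"
    and "subst \<sigma> ` (I \<inter> forms UNIV i) = subst \<sigma> ` I \<inter> forms UNIV i"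
proof -
  obtain \<tau> where s1: "\<And>v. \<sigma> v \<in> forms UNIV 1" and t1: "\<And>v. \<tau> v \<in> forms UNIV 1"
    and "\<And>v. subst \<sigma> (\<tau> v) = Var v" "\<And>v. subst \<tau> (\<sigma> v) = Var v"
    using \<sigma> by (auto simp: linear_change_def)
  then have st: "subst \<sigma> (subst \<tau> p) = p" and ts: "subst \<tau> (subst \<sigma> p) = p" for p
    by (simp_all add: subst_subst subst_Var_id)
  define I' where "I' = subst \<sigma> ` I"
  \<comment> \<open>Membership in the image is tested by the inverse substitution, a ring
    homomorphism, so ideal properties pull back from \<open>I\<close>.\<close>
  have I': "p \<in> I' \<longleftrightarrow> subst \<tau> p \<in> I" for p
  proof
    assume "subst \<tau> p \<in> I"
    then have "subst \<sigma> (subst \<tau> p) \<in> I'" unfolding I'_def by (rule imageI)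
    then show "p \<in> I'" by (simp only: st)
  qed (auto simp: I'_def ts)
  have gr: "graded_ideal UNIV I" and ar: "artinian UNIV I" and go: "gorenstein UNIV I"
    and sd: "socle_degree UNIV I j"
    using AG by (auto simp: graded_AG_def)
  have id: "is_ideal UNIV I" using gr by (simp add: graded_ideal_def)
  have id': "is_ideal UNIV I'"
    unfolding is_ideal_def
    using is_idealD[OF id] by (auto simp: I' subst_add subst_mult)
  have gr': "graded_ideal UNIV I'"
    unfolding graded_ideal_def
  proof (intro conjI ballI allI id')
    fix p i assume "p \<in> I'"
    then have "hcomp i (subst \<tau> p) \<in> I" using gr by (simp add: graded_ideal_def I')
    then show "hcomp i p \<in> I'" by (simp add: I' hcomp_subst[OF t1])
  qed
  have sub: "forms UNIV d \<subseteq> I' \<longleftrightarrow> forms UNIV d \<subseteq> I" for d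
  proof
    assume *: "forms UNIV d \<subseteq> I'"
    show "forms UNIV d \<subseteq> I"
    proof
      fix p :: "'k mpoly" assume "p \<in> forms UNIV d"
      then have "subst \<sigma> p \<in> forms UNIV d" by (rule subst_forms[OF s1])
      then have "subst \<sigma> p \<in> I'" using * by (rule rev_subsetD)
      then show "p \<in> I" by (simp add: I' ts)
    qed
  next
    assume *: "forms UNIV d \<subseteq> I"
    show "forms UNIV d \<subseteq> I'"
    proof
      fix p :: "'k mpoly" assume "p \<in> forms UNIV d"
      then have "subst \<tau> p \<in> forms UNIV d" by (rule subst_forms[OF t1])
      then show "p \<in> I'" using * unfolding I' by (rule rev_subsetD)
    qed
  qed
  obtain s where s: "s \<in> socle UNIV I" "s \<notin> I" "\<And>p. p \<in> socle UNIV I \<Longrightarrow> \<exists>c. p - smult c s \<in> I"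
    using go by (auto simp: gorenstein_def)
  have "gorenstein UNIV I'"
    unfolding gorenstein_def
  proof (intro bexI[of _ "subst \<sigma> s"] conjI ballI)
    show "subst \<sigma> s \<notin> I'" using s(2) by (simp add: I' ts)
    show "subst \<sigma> s \<in> socle UNIV I'"
      using socle_linear_form[OF id s(1) t1] by (simp add: socle_def I' subst_mult subst_Var ts)
    fix p assume p: "p \<in> socle UNIV I'"
    have "Var v * subst \<tau> p \<in> I" for v
    proof -
      have "\<sigma> v * p \<in> I'" using socle_linear_form[OF id' p s1] .
      then have "subst \<tau> (subst \<sigma> (Var v)) * subst \<tau> p \<in> I" by (simp add: I' subst_mult subst_Var)
      then show ?thesis by (simp add: ts)
    qed
    then have "subst \<tau> p \<in> socle UNIV I" by (simp add: socle_def)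
    then obtain c where "subst \<tau> p - smult c s \<in> I" using s(3) by blast
    then have "p - smult c (subst \<sigma> s) \<in> I'" by (simp add: I' subst_diff subst_smult ts)
    then show "\<exists>c. p - smult c (subst \<sigma> s) \<in> I'" ..
  qed
  then have "graded_AG UNIV I' j"
    using gr' ar sd sub by (simp add: graded_AG_def artinian_def socle_degree_def)
  then show "graded_AG UNIV (subst \<sigma> ` I) j" by (simp add: I'_def)
  have inter: "subst \<sigma> ` (I \<inter> forms UNIV i) = I' \<inter> forms UNIV i"
  proof (intro equalityI subsetI)
    fix p assume "p \<in> subst \<sigma> ` (I \<inter> forms UNIV i)"
    then show "p \<in> I' \<inter> forms UNIV i" by (auto simp: I' ts intro: subst_forms[OF s1])
  next
    fix p assume "p \<in> I' \<inter> forms UNIV i"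
    then have "subst \<tau> p \<in> I \<inter> forms UNIV i" by (auto simp: I' intro: subst_forms[OF t1])
    then have "subst \<sigma> (subst \<tau> p) \<in> subst \<sigma> ` (I \<inter> forms UNIV i)" by (rule imageI)
    then show "p \<in> subst \<sigma> ` (I \<inter> forms UNIV i)" by (simp only: st)
  qed
  then show "subst \<sigma> ` (I \<inter> forms UNIV i) = subst \<sigma> ` I \<inter> forms UNIV i" by (simp add: I'_def)
  have img: "subst \<sigma> ` forms UNIV i = forms UNIV i"
  proof (intro equalityI subsetI)
    fix p assume "p \<in> subst \<sigma> ` forms UNIV i"
    then show "p \<in> forms UNIV i" by (auto intro: subst_forms[OF s1])
  next
    fix p :: "'k mpoly" assume "p \<in> forms UNIV i"
    then have "subst \<sigma> (subst \<tau> p) \<in> subst \<sigma> ` forms UNIV i" by (intro imageI subst_forms[OF t1])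
    then show "p \<in> subst \<sigma> ` forms UNIV i" by (simp only: st)
  qed
  have lin: "Vector_Spaces.linear smult smult (subst \<sigma>)"
    by unfold_locales (simp_all add: subst_add subst_smult)
  have "inj (subst \<sigma>)" using ts by (metis injI)
  then have "kdim (subst \<sigma> ` X) = kdim X" for X by (rule kdim_image_injective[OF lin])
  then show "hilb UNIV (subst \<sigma> ` I) i = hilb UNIV I i"
    unfolding hilb_def by (metis I'_def inter img)
qed

subsection \<open>Connected sums from the quadratic part, and the family C(H)\<close>

lemma card_mdeg_1: "card {m. mdeg m = 1 \<and> keys m \<subseteq> UNIV} \<le> 4"
proof -
  have "{m. mdeg m = 1 \<and> keys m \<subseteq> UNIV} \<subseteq> (\<lambda>v. single v 1) ` UNIV" using mdeg_1 by blast
  then have "card {m. mdeg m = 1 \<and> keys m \<subseteq> UNIV} \<le> card ((\<lambda>v. single v (1::nat)) ` (UNIV :: var set))"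
    by (rule card_mono[rotated]) simp
  also have "\<dots> \<le> card (UNIV :: var set)" by (rule card_image_le) simp
  also have "\<dots> = 4" by (simp add: UNIV_var)
  finally show ?thesis .
qed

lemma card_mdeg_2: "card {m. mdeg m = 2 \<and> keys m \<subseteq> R'vars} \<le> 6"
proof -
  let ?f = "\<lambda>(u, v). single u 1 + single v (1::nat)"
  let ?A = "{(vX, vX), (vX, vY), (vX, vZ), (vY, vY), (vY, vZ), (vZ, vZ)}"
  have "{m. mdeg m = 2 \<and> keys m \<subseteq> R'vars} \<subseteq> ?f ` ?A"
  proof
    fix m assume "m \<in> {m. mdeg m = 2 \<and> keys m \<subseteq> R'vars}"
    then have m: "mdeg m = Suc 1" "keys m \<subseteq> R'vars" by auto
    obtain u k where u: "m = single u 1 + k" "mdeg k = 1" using mdeg_pos_split[OF m(1)] by metis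
    obtain v where v: "k = single v 1" using mdeg_1[OF u(2)] by blast
    have "u \<in> R'vars" "v \<in> R'vars" using m(2) by (auto simp: u(1) v keys_add_nat)
    then have "(u, v) \<in> ?A \<or> (v, u) \<in> ?A" by (auto simp: R'vars_def)
    moreover have "m = ?f (u, v)" "m = ?f (v, u)" by (simp_all add: u(1) v add.commute)
    ultimately show "m \<in> ?f ` ?A" by blast
  qed
  then have "card {m. mdeg m = 2 \<and> keys m \<subseteq> R'vars} \<le> card (?f ` ?A)"
    by (rule card_mono[rotated]) simp
  also have "\<dots> \<le> card ?A" by (rule card_image_le) simp
  also have "\<dots> = 6" by simp
  finally show ?thesis .
qed

text \<open>Besides the decomposition of \<open>F\<close>, this supplies the vanishing of J in
  degrees 1 and 2. Degree 1 follows from \<open>I\<close> having no linear form. A form of degree 2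
  in J is a combination of wx, wy, wz, so it vanishes at w = 0, yet it does not involve w.\<close>

lemma obtain_connected_sum:
  fixes I :: "'k::field mpoly set"
  assumes j: "j \<ge> 1" and H1: "hilb UNIV I 1 = 4"
    and I2: "I \<inter> forms UNIV 2 = kspan wxyz"
    and F: "F \<in> forms UNIV j" and IF: "I = Ann UNIV F"
  obtains G \<alpha> where "connected_sum G \<alpha> j" "F = connected_sum.F G \<alpha> j"
    "\<And>h. h \<in> Ann R'vars G \<Longrightarrow> h \<in> forms R'vars 1 \<Longrightarrow> h = 0"
    "\<And>h. h \<in> Ann R'vars G \<Longrightarrow> h \<in> forms R'vars 2 \<Longrightarrow> h = 0"
proof -
  define G where "G = restrict_vars R'vars F"
  define \<alpha> where "\<alpha> = lookup F (single vW j)"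
  have id: "is_ideal UNIV I" unfolding IF by (rule is_ideal_Ann)
  have I1: "h = 0" if "h \<in> I" "h \<in> forms UNIV 1" for h
    using hilb_full[OF id _ that] card_mdeg_1 H1 by simp
  have "contract b F = 0" if "b \<in> wxyz" for b
  proof -
    have "b \<in> I" using I2 mp.span_base[OF that] by blast
    then show ?thesis by (simp add: IF Ann_def)
  qed
  then have FG: "F = G + smult \<alpha> (DPow vW j)"
    unfolding G_def \<alpha>_def using decompose_of_contract_wxyz[OF F j] by blast
  have Gj: "G \<in> forms R'vars j" unfolding G_def using F by (rule restrict_vars_forms)
  have nz: "Var v \<noteq> (0 :: 'k mpoly)" for v
    by (simp add: Var_def) (metis lookup_single_eq lookup_zero one_neq_zero)
  have "G \<noteq> 0"
  proof
    assume "G = 0"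
    have "keys (single vX (1::nat)) \<noteq> keys (single vW (1::nat))" by simp
    then have "single vX (1::nat) \<noteq> single vW 1" by metis
    then have "lookup (Var vX :: 'k mpoly) (single vW 1) = 0"
      unfolding Var_def by (rule lookup_single_not_eq)
    then have "contract (Var vX) (DPow vW j) = (0 :: 'k mpoly)"
      by (subst contract_DPow[OF Var_forms[of vX UNIV] j]) simp_all
    then have "Var vX \<in> I" by (simp add: IF FG \<open>G = 0\<close> Ann_def contract_smult_right)
    then show False using I1[OF _ Var_forms] nz by blast
  qed
  moreover have "\<alpha> \<noteq> 0"
  proof
    assume "\<alpha> = 0"
    have "contract (Var vW) G = 0"
      using contract_restrict_vars[OF forms_polyring[OF Gj], of "Var vW"]
      by (simp add: Var_def restrict_vars_single)
    then have "Var vW \<in> I" by (simp add: IF FG \<open>\<alpha> = 0\<close> Ann_def)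
    then show False using I1[OF _ Var_forms] nz by blast
  qed
  ultimately have cs: "connected_sum G \<alpha> j" using Gj j by unfold_locales
  interpret connected_sum G \<alpha> j by (fact cs)
  have FF: "F = connected_sum.F G \<alpha> j" by (simp add: FG connected_sum.F_def[OF cs])
  have IA: "I = Ann UNIV (connected_sum.F G \<alpha> j)" by (simp add: IF FF)
  have JI: "h \<in> I" if "h \<in> Ann R'vars G" for h
    using that I_inter_R' unfolding IA by blast
  show ?thesis
  proof (rule that[OF cs FF])
    show "h = 0" if "h \<in> Ann R'vars G" "h \<in> forms R'vars 1" for h
      using I1[OF JI[OF that(1)]] forms_mono[of R'vars UNIV h 1] that(2) by blast
    show "h = 0" if h: "h \<in> Ann R'vars G" "h \<in> forms R'vars 2" for h
    proof -
      have "h \<in> kspan wxyz" unfolding I2[symmetric]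
        using JI[OF h(1)] forms_mono[of R'vars UNIV h 2] h(2) by blast
      moreover have "kspan wxyz \<subseteq> {p. restrict_vars R'vars p = (0 :: 'k mpoly)}"
      proof (rule mp.span_minimal)
        show "mp.subspace {p. restrict_vars R'vars p = (0 :: 'k mpoly)}"
          by (simp add: mp.subspace_def restrict_vars_add restrict_vars_smult)
      qed (use restrict_wxyz in blast)
      ultimately have "restrict_vars R'vars h = 0" by blast
      then show "h = 0" using h(2) by (simp add: restrict_vars_id forms_polyring)
    qed
  qed
qed

section \<open>The two implications of part (iii)\<close>

lemma C_nonempty_imp_gor_seq:
  fixes H :: "nat \<Rightarrow> nat"
  assumes C: "C_nonempty H TYPE('k::field)" and s: "s \<ge> 4" and H1: "H 1 = 4"
    and Hs: "H s \<noteq> 0" "\<And>i. i > s \<Longrightarrow> H i = 0"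
  shows "gor_seq TYPE('k) R'vars (\<lambda>i. if 1 \<le> i \<and> i \<le> s - 1 then H i - 1 else H i)"
proof -
  obtain I :: "'k mpoly set" and j and \<sigma> where AG: "graded_AG UNIV I j" and HI: "\<And>i. hilb UNIV I i = H i"
    and \<sigma>: "linear_change \<sigma>" and I2: "subst \<sigma> ` (I \<inter> forms UNIV 2) = kspan wxyz"
    using C unfolding C_nonempty_def by blast
  define I' where "I' = subst \<sigma> ` I"
  note tr = linear_change_graded_AG[OF \<sigma> AG, folded I'_def]
  have id: "is_ideal UNIV I'" and sd: "socle_degree UNIV I' j"
    using tr(1) by (auto simp: graded_AG_def graded_ideal_def)
  have HI': "hilb UNIV I' i = H i" for i using tr(2) HI by simp
  \<comment> \<open>\<open>C_nonempty\<close> only asserts some socle degree; it is the last degree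
    with nonzero Hilbert function, hence \<open>s\<close>.\<close>
  have js: "j = s"
  proof -
    have "H j \<noteq> 0" using sd hilb_eq_0_iff[OF id, of j] HI' by (simp add: socle_degree_def)
    moreover have "H i = 0" if "i > j" for i
      using sd hilb_eq_0_iff[OF id, of i] HI' that by (simp add: socle_degree_def)
    ultimately show ?thesis using Hs by (meson linorder_neqE_nat)
  qed
  obtain F where F: "F \<in> forms UNIV s" "I' = Ann UNIV F"
    using graded_AG_obtain_dual_generator[OF tr(1)] js by blast
  obtain G \<alpha> where cs: "connected_sum G \<alpha> s" and FF: "F = connected_sum.F G \<alpha> s"
  proof (rule obtain_connected_sum[OF _ _ _ F])
    show "1 \<le> s" using s by simp
    show "hilb UNIV I' 1 = 4" using HI' H1 by simp
    show "I' \<inter> forms UNIV 2 = kspan wxyz" using I2 tr(3)[of 2] by simp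
  qed
  interpret connected_sum G \<alpha> s by (fact cs)
  \<comment> \<open>In the middle degrees \<open>hilb_I\<close> exhibits \<open>H i\<close> as a
    successor, so \<open>H i - 1\<close> is an exact difference.\<close>
  have "hilb R'vars (Ann R'vars G) i = (if 1 \<le> i \<and> i \<le> s - 1 then H i - 1 else H i)" for i
    using hilb_I[of i] HI'[of i] F(2) FF by (auto split: if_splits)
  then show ?thesis
    unfolding gor_seq_def using graded_AG_Ann[OF G G0] by blast
qed

lemma forms_subset_ideal_mono:
  fixes I :: "'k::comm_ring_1 mpoly set"
  assumes I: "is_ideal V I" and "forms V d \<subseteq> I" "d \<le> e"
  shows "forms V e \<subseteq> I"
  using assms(3)
proof (induct e rule: dec_induct)
  case (step e)
  show ?case
  proof
    fix p :: "'k mpoly" assume p: "p \<in> forms V (Suc e)"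
    have "single m c \<in> I" if m: "m \<in> keys p" for m c
    proof -
      have mV: "keys m \<subseteq> V" "mdeg m = Suc e" using p m by (auto simp: forms_def polyring_def)
      obtain v k where vk: "v \<in> keys m" "m = single v 1 + k" "mdeg k = e"
        using mdeg_pos_split[OF mV(2)] .
      have "keys k \<subseteq> V" using mV(1) vk(2) by (auto simp: keys_add_nat)
      then have "single k c \<in> I" using vk(3) step(3) forms_single by blast
      moreover have "(Var v :: 'k mpoly) \<in> polyring V"
        using vk(1) mV(1) by (intro forms_polyring[OF Var_forms]) blast
      ultimately have "Var v * single k c \<in> I" by (rule is_idealD(4)[OF I])
      then show ?thesis by (simp add: Var_def mult_single vk(2))
    qed
    then show "p \<in> I" by (subst mpoly_sum_single) (rule is_ideal_sum[OF I])
  qed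
qed (use assms(2) in simp)

lemma linear_change_Var: "linear_change Var"
  unfolding linear_change_def
  by (intro conjI allI exI[of _ Var] Var_forms subst_Var_id UNIV_I)

lemma gor_seq_imp_C_nonempty:
  fixes H :: "nat \<Rightarrow> nat"
  assumes gs: "gor_seq TYPE('k::field) R'vars (\<lambda>i. if 1 \<le> i \<and> i \<le> s - 1 then H i - 1 else H i)"
    and s: "s \<ge> 4" and H2: "H 2 = 7" and Hs: "H s \<noteq> 0" "\<And>i. i > s \<Longrightarrow> H i = 0"
  shows "C_nonempty H TYPE('k)"
proof -
  obtain J0 :: "'k mpoly set" and j where AG: "graded_AG R'vars J0 j"
    and HJ: "\<And>i. hilb R'vars J0 i = (if 1 \<le> i \<and> i \<le> s - 1 then H i - 1 else H i)"
    using gs unfolding gor_seq_def by blast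
  have id: "is_ideal R'vars J0" and sd: "socle_degree R'vars J0 j"
    using AG by (auto simp: graded_AG_def graded_ideal_def)
  have HJs: "hilb R'vars J0 s \<noteq> 0" using HJ[of s] Hs(1) s by auto
  have js: "j = s"
  proof -
    have "hilb R'vars J0 j \<noteq> 0" using sd hilb_eq_0_iff[OF id, of j] by (simp add: socle_degree_def)
    then have "\<not> j > s" using HJ[of j] Hs(2)[of j] by (auto split: if_splits)
    moreover have "\<not> s > j" using sd hilb_eq_0_iff[OF id, of s] HJs by (auto simp: socle_degree_def)
    ultimately show ?thesis by simp
  qed
  \<comment> \<open>A zero before degree \<open>s\<close> would propagate up to \<open>s\<close>.
    This positivity guards against truncation: where \<open>H i - 1\<close> is nonzero, adding 1
    gives back \<open>H i\<close>.\<close>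
  have pos: "hilb R'vars J0 i \<noteq> 0" if "i \<le> s" for i
    using forms_subset_ideal_mono[OF id _ that] HJs by (auto simp: hilb_eq_0_iff[OF id])
  obtain G where G': "G \<in> forms R'vars s" "G \<noteq> 0" "J0 = Ann R'vars G"
    using graded_AG_obtain_dual_generator[OF AG] js by blast
  interpret connected_sum G 1 s
    using G' s by unfold_locales auto
  have HI: "hilb UNIV I i = H i" for i
    using hilb_I[of i] HJ[of i] pos[of i] by (auto simp: G'(3) split: if_splits) arith
  \<comment> \<open>H'(2) = 7 - 1 = 6 is the number of quadratic monomials in x, y, z, so
    \<open>hilb_full\<close> leaves no quadric in \<open>J\<close>.\<close>
  have "h = 0" if "h \<in> J" "h \<in> forms R'vars 2" for h
    using hilb_full[OF id_J _ that] card_mdeg_2 HJ[of 2] H2 s by (simp add: G'(3))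
  then have J2: "restrict_vars R'vars h = 0" if "h \<in> I \<inter> forms UNIV 2" for h
    using that I_iff[of h 2] s restrict_vars_forms[of h UNIV 2 R'vars] by auto
  have I2: "I \<inter> forms UNIV 2 = kspan wxyz"
  proof
    show "kspan wxyz \<subseteq> I \<inter> forms UNIV 2"
      using wxyz_I wxyz_forms
      by (intro mp.span_minimal mp.subspace_inter subspace_forms subspace_ideal[OF id_I]) blast
    show "I \<inter> forms UNIV 2 \<subseteq> kspan wxyz"
    proof
      fix h assume h: "h \<in> I \<inter> forms UNIV 2"
      \<comment> \<open>A quadric of \<open>I\<close> has no monomial in x, y, z alone and no w^2 by
        \<open>I_iff\<close>, so each of its monomials is wx, wy or wz. The quadratic part is
        already in the required form and \<open>Var\<close> serves as coordinate change.\<close>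
      have mixed: "single m (lookup h m) \<in> kspan wxyz" if m: "m \<in> keys h" for m
      proof -
        have deg: "mdeg m = 2" using h m by (auto simp: forms_def)
        have "\<not> keys m \<subseteq> R'vars"
        proof
          assume "keys m \<subseteq> R'vars"
          then have "lookup h m = lookup (restrict_vars R'vars h) m" by simp
          then show False using J2[OF h] m by (simp add: in_keys_iff)
        qed
        moreover have "m \<noteq> single vW (mdeg m)"
          using I_iff[of h 2] h s m by (auto simp: deg in_keys_iff)
        ultimately obtain v k where vk: "v \<in> R'vars" "m = single vW 1 + single v 1 + k"
          using mixed_monomial by blast
        then have "k = 0" using deg by (simp add: mdeg_eq_0_iff)
        then have "single m (lookup h m) = smult (lookup h m) (single (single vW 1 + single v 1) 1)"
          by (simp add: vk(2) smult_single)
        moreover have "single (single vW 1 + single v 1) 1 \<in> (wxyz :: 'k mpoly set)"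
          using vk(1) unfolding wxyz_iff by blast
        ultimately show ?thesis by (simp only:) (intro mp.span_scale mp.span_base)
      qed
      show "h \<in> kspan wxyz"
        by (subst mpoly_sum_single) (rule mp.span_sum[OF mixed])
    qed
  qed
  have "subst Var ` X = X" for X :: "'k mpoly set" by (simp add: subst_Var_id)
  then show ?thesis
    unfolding C_nonempty_def
    using graded_AG_Ann[OF F_forms F0] HI I2 linear_change_Var by metis
qed

theorem theorem3p7:
  fixes I :: "'k::field mpoly set" and F :: "'k mpoly" and j :: nat
  assumes K: "alg_closed TYPE('k)"
    and j: "j \<ge> 4"
    and AG: "graded_AG UNIV I j"
    and H1: "hilb UNIV I 1 = 4" and H2: "hilb UNIV I 2 = 7"
    and I2: "I \<inter> forms UNIV 2 = kspan {Var vW * Var vX, Var vW * Var vY, Var vW * Var vZ}"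
    and Fj: "F \<in> forms UNIV j" and F0: "F \<noteq> 0"
    and IF: "I = Ann UNIV F"
  shows
    \<comment> \<open>(i)\<close>
    "perp UNIV (ideal_gen UNIV {Var vW * Var vX, Var vW * Var vY, Var vW * Var vZ}) \<inter> forms UNIV j
       = kspan (forms R'vars j \<union> {DPow vW j})
     \<and>
    \<comment> \<open>(ii)\<close>
     (\<exists>G \<alpha>. G \<in> forms R'vars j \<and> G \<noteq> 0 \<and> \<alpha> \<noteq> 0 \<and> F = G + smult \<alpha> (DPow vW j) \<and>
        (let J = I \<inter> polyring R'vars in
          J = Ann R'vars G \<and> graded_AG R'vars J j \<and>
          (\<exists>g. g \<in> forms R'vars j \<and> g \<noteq> 0 \<and> g \<notin> J \<and>
             I = ideal_gen UNIV (J \<union> {Var vW * Var vX, Var vW * Var vY, Var vW * Var vZ, DPow vW j - g}) \<and>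
             (\<forall>B. minimal_gens R'vars J B \<longrightarrow>
                minimal_gens UNIV I (B \<union> {Var vW * Var vX, Var vW * Var vY, Var vW * Var vZ, DPow vW j - g}))) \<and>
          (\<forall>i. hilb UNIV I i = hilb R'vars J i + (if 1 \<le> i \<and> i \<le> j - 1 then 1 else 0)) \<and>
          perp UNIV I \<inter> forms UNIV j = kspan {F} \<and>
          (\<forall>i>j. perp UNIV I \<inter> forms UNIV i = {0}) \<and>
          (\<forall>i. 1 \<le> i \<and> i \<le> j - 1 \<longrightarrow>
             perp UNIV I \<inter> forms UNIV i = act_orbit UNIV F \<inter> forms UNIV i \<and>
             act_orbit UNIV F \<inter> forms UNIV i
               = kspan ((act_orbit R'vars G \<inter> forms R'vars i) \<union> {DPow vW i}))))
     \<and>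
    \<comment> \<open>(iii)\<close>
     (\<forall>(H::nat \<Rightarrow> nat) s. s \<ge> 4 \<longrightarrow> gor_seq TYPE('k) UNIV H \<longrightarrow> H 0 = 1 \<longrightarrow> H 1 = 4 \<longrightarrow> H 2 = 7 \<longrightarrow>
        H s \<noteq> 0 \<longrightarrow> (\<forall>i>s. H i = 0) \<longrightarrow>
        (C_nonempty H TYPE('k) \<longleftrightarrow>
           (let H' = (\<lambda>i. if 1 \<le> i \<and> i \<le> s - 1 then H i - 1 else H i)
            in gor_seq TYPE('k) R'vars H' \<and> H' 1 = 3)))"
proof -
  obtain G \<alpha> where cs: "connected_sum G \<alpha> j" and FF: "F = connected_sum.F G \<alpha> j"
    and J1: "\<And>h. h \<in> Ann R'vars G \<Longrightarrow> h \<in> forms R'vars 1 \<Longrightarrow> h = 0"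
    and J2: "\<And>h. h \<in> Ann R'vars G \<Longrightarrow> h \<in> forms R'vars 2 \<Longrightarrow> h = 0"
    using obtain_connected_sum[OF _ H1 I2 Fj IF] j by auto
  interpret cs: connected_sum G \<alpha> j by (fact cs)
  have I: "I = Ann UNIV cs.F" using IF FF by simp
  obtain g where g: "g \<in> forms R'vars j" "contract g G = single 0 \<alpha>" by (rule cs.obtain_g)
  have J: "I \<inter> polyring R'vars = Ann R'vars G" unfolding I by (rule cs.I_inter_R')
  have un: "wxyz \<union> {DPow vW j - g} = {Var vW * Var vX, Var vW * Var vY, Var vW * Var vZ, DPow vW j - g}"
    by auto
  have j3: "j \<ge> 3" "j \<ge> 1" using j by auto
  have part2: "\<exists>G \<alpha>. G \<in> forms R'vars j \<and> G \<noteq> 0 \<and> \<alpha> \<noteq> 0 \<and> F = G + smult \<alpha> (DPow vW j) \<and>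
        (let J = I \<inter> polyring R'vars in
          J = Ann R'vars G \<and> graded_AG R'vars J j \<and>
          (\<exists>g. g \<in> forms R'vars j \<and> g \<noteq> 0 \<and> g \<notin> J \<and>
             I = ideal_gen UNIV (J \<union> {Var vW * Var vX, Var vW * Var vY, Var vW * Var vZ, DPow vW j - g}) \<and>
             (\<forall>B. minimal_gens R'vars J B \<longrightarrow>
                minimal_gens UNIV I (B \<union> {Var vW * Var vX, Var vW * Var vY, Var vW * Var vZ, DPow vW j - g}))) \<and>
          (\<forall>i. hilb UNIV I i = hilb R'vars J i + (if 1 \<le> i \<and> i \<le> j - 1 then 1 else 0)) \<and>
          perp UNIV I \<inter> forms UNIV j = kspan {F} \<and>
          (\<forall>i>j. perp UNIV I \<inter> forms UNIV i = {0}) \<and>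
          (\<forall>i. 1 \<le> i \<and> i \<le> j - 1 \<longrightarrow>
             perp UNIV I \<inter> forms UNIV i = act_orbit UNIV F \<inter> forms UNIV i \<and>
             act_orbit UNIV F \<inter> forms UNIV i
               = kspan ((act_orbit R'vars G \<inter> forms R'vars i) \<union> {DPow vW i})))"
    unfolding Let_def J
  proof (rule exI[of _ G], rule exI[of _ \<alpha>], intro conjI exI[of _ g] allI impI)
    show "F = G + smult \<alpha> (DPow vW j)" by (simp add: FF cs.F_def)
    show "graded_AG R'vars (Ann R'vars G) j" by (rule graded_AG_Ann[OF cs.G cs.G0])
    show "I = ideal_gen UNIV (Ann R'vars G \<union>
        {Var vW * Var vX, Var vW * Var vY, Var vW * Var vZ, DPow vW j - g})"
      unfolding I un[symmetric] by (rule cs.I_generators[OF g])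
    show "minimal_gens UNIV I (B \<union> {Var vW * Var vX, Var vW * Var vY, Var vW * Var vZ, DPow vW j - g})"
      if "minimal_gens R'vars (Ann R'vars G) B" for B
      unfolding I un[symmetric] by (rule cs.minimal_gens_I[OF J1 g J2 j3(1) that])
    show "hilb UNIV I i = hilb R'vars (Ann R'vars G) i + (if 1 \<le> i \<and> i \<le> j - 1 then 1 else 0)" for i
      unfolding I by (rule cs.hilb_I)
    show "perp UNIV I \<inter> forms UNIV j = kspan {F}" unfolding I FF by (rule cs.perp_I_j)
    show "perp UNIV I \<inter> forms UNIV i = {0}" if "j < i" for i
      unfolding I by (rule cs.perp_I_high[OF that])
    show "perp UNIV I \<inter> forms UNIV i = act_orbit UNIV F \<inter> forms UNIV i" if "1 \<le> i \<and> i \<le> j - 1" for i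
      unfolding I FF using that by (intro cs.perp_I_orbit) arith
    show "act_orbit UNIV F \<inter> forms UNIV i = kspan (act_orbit R'vars G \<inter> forms R'vars i \<union> {DPow vW i})"
      if "1 \<le> i \<and> i \<le> j - 1" for i
      unfolding FF using that by (intro cs.orbit_F) simp_all
  qed (use cs.G cs.G0 cs.\<alpha>0 g cs.g0[OF g] cs.g_notin_J[OF g] in simp_all)
  \<comment> \<open>The condition \<open>H' 1 = 3\<close> is automatic from \<open>H 1 = 4\<close>,
    since 1 lies in the range where one is subtracted.\<close>
  have part3: "C_nonempty H TYPE('k) \<longleftrightarrow>
           (let H' = (\<lambda>i. if 1 \<le> i \<and> i \<le> s - 1 then H i - 1 else H i)
            in gor_seq TYPE('k) R'vars H' \<and> H' 1 = 3)"
    if "s \<ge> 4" "H 1 = 4" "H 2 = 7" "H s \<noteq> 0" "\<forall>i>s. H i = 0" for H :: "nat \<Rightarrow> nat" and s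
    unfolding Let_def
    using that C_nonempty_imp_gor_seq[of H s, where 'k = 'k] gor_seq_imp_C_nonempty[of s H, where 'k = 'k] by auto
  show ?thesis
    using perp_wxyz[OF j3(2)] part2 part3 by blast
qed

end
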